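(* Let $G$ be any finite group of automorphisms of a mixing SFT $X$ (that is, a finite subgroup of $\mathrm{Aut}(X)$), and let $\Gamma$ be any finite alphabet. Then there is an embedding (injective group homomorphism) $\phi : \mathrm{Aut}(\Gamma^{\mathbb{Z}}) \to \mathrm{Aut}(X)$ such that $\phi(f)$ commutes with $g$ for all $f \in \mathrm{Aut}(\Gamma^{\mathbb{Z}})$ and all $g \in G$.
   Context: For a finite alphabet $\Sigma$, $\Sigma^{\mathbb{Z}}$ has the product topology and the shift is $\sigma(x)_i = x_{i+1}$. A subshift is a closed set $X \subset \Sigma^{\mathbb{Z}}$ with $\sigma(X) = X$; it is an SFT if it is the set of points avoiding some finite set of forbidden words, and it is mixing if $(X,\sigma)$ is topologically mixing. $\mathrm{Aut}(X)$ is the group, under composition, of homeomorphisms $f : X \to X$ commuting with $\sigma$.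
   Formalization: The formal theorem additionally assumes that X has at least two points whenever Γ has at least two letters; otherwise Aut(X) is trivial while Aut(Γ^Z) is infinite, so no embedding exists. *)

theory Defs
  imports "HOL-Analysis.Analysis" "HOL-Algebra.Bij"
begin

definition shift :: "(int \<Rightarrow> 'a) \<Rightarrow> int \<Rightarrow> 'a"
  where "shift x = (\<lambda>i. x (i + 1))"

definition full_topology :: "'a set \<Rightarrow> (int \<Rightarrow> 'a) topology"
  where "full_topology \<Sigma> = product_topology (\<lambda>_. discrete_topology \<Sigma>) UNIV"

abbreviation full_shift :: "'a set \<Rightarrow> (int \<Rightarrow> 'a) set"
  where "full_shift \<Sigma> \<equiv> UNIV \<rightarrow> \<Sigma>"

definition subshift :: "'a set \<Rightarrow> (int \<Rightarrow> 'a) set \<Rightarrow> bool"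
  where "subshift \<Sigma> X \<longleftrightarrow> closedin (full_topology \<Sigma>) X \<and> shift ` X = X"

definition occurs_at :: "'a list \<Rightarrow> (int \<Rightarrow> 'a) \<Rightarrow> int \<Rightarrow> bool"
  where "occurs_at w x i \<longleftrightarrow> (\<forall>k<length w. x (i + int k) = w ! k)"

definition sft :: "'a set \<Rightarrow> (int \<Rightarrow> 'a) set \<Rightarrow> bool"
  where "sft \<Sigma> X \<longleftrightarrow> subshift \<Sigma> X \<and>
    (\<exists>F. finite F \<and> F \<subseteq> lists \<Sigma> \<and>
         X = {x \<in> full_shift \<Sigma>. \<forall>w\<in>F. \<forall>i. \<not> occurs_at w x i})"

definition mixing :: "'a set \<Rightarrow> (int \<Rightarrow> 'a) set \<Rightarrow> bool"
  where "mixing \<Sigma> X \<longleftrightarrow>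
    (\<forall>U V. openin (subtopology (full_topology \<Sigma>) X) U \<and> U \<noteq> {} \<and>
           openin (subtopology (full_topology \<Sigma>) X) V \<and> V \<noteq> {} \<longrightarrow>
           (\<exists>N. \<forall>n\<ge>N. (shift ^^ n) ` U \<inter> V \<noteq> {}))"

text \<open>Elements of \<open>Bij X\<close> are extensional, i.e. \<open>undefined\<close> outside \<open>X\<close>, so that two
  automorphisms are equal as soon as they agree on \<open>X\<close>.\<close>

definition Aut :: "'a set \<Rightarrow> (int \<Rightarrow> 'a) set \<Rightarrow> ((int \<Rightarrow> 'a) \<Rightarrow> (int \<Rightarrow> 'a)) monoid"
  where "Aut \<Sigma> X = (BijGroup X)\<lparr>carrier :=
    {f \<in> Bij X.
       homeomorphic_map (subtopology (full_topology \<Sigma>) X) (subtopology (full_topology \<Sigma>) X) f \<and>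
       (\<forall>x\<in>X. f (shift x) = shift (f x))}\<rparr>"

lemma topspace_full_topology [simp]: "topspace (full_topology \<Sigma>) = full_shift \<Sigma>"
  by (auto simp: full_topology_def PiE_def)

lemma subshift_full_shift: "subshift \<Sigma> (full_shift \<Sigma>)"
proof -
  have "x \<in> shift ` full_shift \<Sigma>" if "x \<in> full_shift \<Sigma>" for x
    by (rule image_eqI[of _ _ "\<lambda>i. x (i - 1)"]) (use that in \<open>auto simp: shift_def\<close>)
  moreover have "closedin (full_topology \<Sigma>) (full_shift \<Sigma>)"
    by (metis closedin_topspace topspace_full_topology)
  ultimately show ?thesis
    by (auto simp: subshift_def shift_def)
qed

lemma group_Aut:
  assumes "subshift \<Sigma> X"
  shows "group (Aut \<Sigma> X)"
proof -
  let ?T = "subtopology (full_topology \<Sigma>) X"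
  let ?A = "{f \<in> Bij X. homeomorphic_map ?T ?T f \<and> (\<forall>x\<in>X. f (shift x) = shift (f x))}"
  have XT: "topspace ?T = X"
    using closedin_subset[of "full_topology \<Sigma>" X] assms
    by (auto simp: subshift_def)
  have sX: "shift x \<in> X" if "x \<in> X" for x
    using that assms by (auto simp: subshift_def)
  interpret B: group "BijGroup X"
    by (rule group_BijGroup)
  have "subgroup ?A (BijGroup X)"
  proof (rule B.subgroupI)
    show "?A \<subseteq> carrier (BijGroup X)"
      by (auto simp: BijGroup_def)
    have "(\<lambda>x\<in>X. x) \<in> ?A"
      using id_Bij sX homeomorphic_map_eq[of ?T ?T id "\<lambda>x\<in>X. x"] XT by auto
    then show "?A \<noteq> {}"
      by blast
  next
    fix f assume f: "f \<in> ?A"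
    then have bf: "bij_betw f X X"
      by (auto simp: Bij_def)
    let ?g = "restrict (inv_into X f) X"
    have inv: "inv\<^bsub>BijGroup X\<^esub> f = ?g"
      using f inv_BijGroup[of f X] by simp
    have gX: "?g y \<in> X" if "y \<in> X" for y
      using bf that by (auto simp: bij_betw_def inv_into_into)
    have fg: "f (?g y) = y" if "y \<in> X" for y
      using bf that by (simp add: bij_betw_inv_into_right)
    have gf: "?g (f x) = x" if "x \<in> X" for x
      using bf that by (auto simp: bij_betw_inv_into_left bij_betwE)
    have "?g \<in> Bij X"
      using f restrict_inv_into_Bij by blast
    moreover have "homeomorphic_map ?T ?T ?g"
    proof -
      obtain h where h: "homeomorphic_maps ?T ?T f h"
        using f homeomorphic_map_maps by blast
      then have hm: "homeomorphic_map ?T ?T h"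
        by (meson homeomorphic_maps_map)
      have "h y = ?g y" if "y \<in> X" for y
      proof -
        have "h (f (?g y)) = ?g y"
          using h gX[OF that] XT by (metis homeomorphic_maps_def)
        then show ?thesis
          using fg[OF that] by simp
      qed
      then show ?thesis
        using homeomorphic_map_eq[OF hm] XT by blast
    qed
    moreover have "?g (shift x) = shift (?g x)" if "x \<in> X" for x
    proof -
      have "f (shift (?g x)) = shift (f (?g x))"
        using f gX[OF that] by blast
      then have "f (shift (?g x)) = shift x"
        using fg[OF that] by simp
      then show ?thesis
        using gf[OF sX[OF gX[OF that]]] by metis
    qed
    ultimately show "inv\<^bsub>BijGroup X\<^esub> f \<in> ?A"
      unfolding inv by blast
  next
    fix f g assume f: "f \<in> ?A" and g: "g \<in> ?A"
    have gX: "g x \<in> X" if "x \<in> X" for x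
      using g that by (auto simp: Bij_def bij_betwE)
    have "f \<otimes>\<^bsub>BijGroup X\<^esub> g = compose X f g"
      using f g by (simp add: BijGroup_def)
    moreover have "compose X f g \<in> Bij X"
      using f g compose_Bij by blast
    moreover have "homeomorphic_map ?T ?T (compose X f g)"
    proof (rule homeomorphic_map_eq)
      show "homeomorphic_map ?T ?T (f \<circ> g)"
        using f g homeomorphic_map_compose by blast
    qed (use XT in \<open>auto simp: compose_def\<close>)
    moreover have "compose X f g (shift x) = shift (compose X f g x)" if "x \<in> X" for x
      using f g that gX sX by (simp add: compose_def)
    ultimately show "f \<otimes>\<^bsub>BijGroup X\<^esub> g \<in> ?A"
      by simp
  qed
  then show ?thesis
    unfolding Aut_def by (rule B.subgroup_imp_group)
qed

end

(*
Proof idea.  Take a finite family of words W a, one for each a in Gamma x Gamma, which differ only in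
their middle part and which overlap neither with each other nor, after applying any non-trivial g in G,
with their images under g, except in their margins.  An occurrence of a word W a in g x is a "cell" of x
of type g; the data of all cells of all types can be overwritten simultaneously and independently.
Maximal runs of adjacent cells of the same type are read as conveyor belts: the first components form
the upper track, read to the right, and the second components the lower track, read to the left, and
the tracks are joined at the ends of the run.  Every cell sees a bi-infinite sequence over Gamma along
its belt, and f acts on these sequences; since f commutes with the shift, this is an action.  It commutes
with G because G only permutes the types of the cells.

The words are made of two blocks of equal length P which can be concatenated freely.  If u marks
a single block 1 in a sea of 0s, then u is not fixed by any non-trivial combination of a shift and an
element of G.  This excludes small displacements of one cell against another; the large ones are excluded
because block 0 repeated is P-periodic, P-periodicity survives the application of g up to the coding
radius r, and block 1 breaks it.
*)

theory Submission
  imports Defs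
begin

section \<open>Sliding block codes\<close>

definition translate :: "int \<Rightarrow> (int \<Rightarrow> 'a) \<Rightarrow> int \<Rightarrow> 'a"
  where "translate k x = (\<lambda>i. x (i + k))"

lemma translate_apply: "translate k x i = x (i + k)"
  by (simp add: translate_def)

lemma translate_0 [simp]: "translate 0 x = x"
  by (simp add: translate_def)

lemma translate_translate [simp]: "translate k (translate l x) = translate (k + l) x"
  by (auto simp: translate_def add_ac)

lemma shift_eq_translate: "shift = translate 1"
  by (auto simp: shift_def translate_def)

lemma shift_power: "(shift ^^ n) x = translate (int n) x"
  by (induction n) (simp_all add: shift_eq_translate add_ac)

lemma closed_under_translate:
  assumes "shift ` X = X" "x \<in> X"
  shows "translate k x \<in> X"
proof -
  have up: "translate 1 y \<in> X" if "y \<in> X" for y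
    using assms(1) that by (auto simp: shift_eq_translate)
  have down: "translate (-1) y \<in> X" if "y \<in> X" for y
  proof -
    have "y \<in> shift ` X"
      using assms(1) that by simp
    then obtain v where "v \<in> X" "y = translate 1 v"
      unfolding shift_eq_translate by (rule imageE)
    then show ?thesis
      by simp
  qed
  show ?thesis
  proof (induction k rule: int_induct[where k = 0])
    case base
    show ?case using assms by simp
  next
    case (step1 i)
    then show ?case using up[of "translate i x"] by (simp add: add_ac)
  next
    case (step2 i)
    then show ?case using down[of "translate i x"] by simp
  qed
qed

lemma commutes_with_translate:
  assumes "shift ` X = X" "\<And>x. x \<in> X \<Longrightarrow> f (shift x) = shift (f x)" "x \<in> X"
  shows "f (translate k x) = translate k (f x)"
proof (induction k rule: int_induct[where k = 0])
  case base
  show ?case by simp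
next
  case (step1 i)
  then show ?case
    using assms(2)[of "translate i x"] closed_under_translate[OF assms(1,3)]
    by (simp add: shift_eq_translate add_ac)
next
  case (step2 i)
  have "f (translate i x) = translate 1 (f (translate (i - 1) x))"
    using assms(2)[of "translate (i - 1) x"] closed_under_translate[OF assms(1,3)]
    by (simp add: shift_eq_translate)
  then have "f (translate (i - 1) x) = translate (-1) (f (translate i x))"
    by simp
  also have "\<dots> = translate (-1) (translate i (f x))"
    by (simp only: step2)
  finally show ?case by simp
qed

text \<open>A basic open set constrains finitely many coordinates, which all lie in one window
  around 0. From here on topology enters only through such windows and compactness.\<close>

lemma openin_subtopology_full_iff:
  assumes X: "X \<subseteq> full_shift \<Sigma>"
  shows "openin (subtopology (full_topology \<Sigma>) X) U \<longleftrightarrow>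
    U \<subseteq> X \<and> (\<forall>x\<in>U. \<exists>r. \<forall>y\<in>X. (\<forall>j. \<bar>j\<bar> \<le> r \<longrightarrow> y j = x j) \<longrightarrow> y \<in> U)"
    (is "?L \<longleftrightarrow> ?R")
proof
  assume ?L
  then obtain S where S: "openin (full_topology \<Sigma>) S" and U: "U = S \<inter> X"
    by (auto simp: openin_subtopology)
  have "\<exists>r. \<forall>y\<in>X. (\<forall>j. \<bar>j\<bar> \<le> r \<longrightarrow> y j = x j) \<longrightarrow> y \<in> U" if "x \<in> U" for x
  proof -
    have "x \<in> S" using that U by blast
    then obtain V where "finite {i \<in> UNIV. V i \<noteq> topspace (discrete_topology \<Sigma>)}"
      and x: "x \<in> Pi\<^sub>E UNIV V" and sub: "Pi\<^sub>E UNIV V \<subseteq> S"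
      using S unfolding full_topology_def openin_product_topology_alt by blast
    then have fin: "finite {i. V i \<noteq> \<Sigma>}" by simp
    define r where "r = Max (insert 0 (abs ` {i. V i \<noteq> \<Sigma>}))"
    have "y \<in> U" if "y \<in> X" "\<forall>j. \<bar>j\<bar> \<le> r \<longrightarrow> y j = x j" for y
    proof -
      have "y i \<in> V i" for i
      proof (cases "V i = \<Sigma>")
        case True
        then show ?thesis using that X by auto
      next
        case False
        then have "\<bar>i\<bar> \<le> r"
          unfolding r_def using fin by (intro Max_ge) auto
        then show ?thesis using that x by (auto simp: PiE_iff)
      qed
      then show ?thesis
        using sub that U by (auto simp: PiE_iff)
    qed
    then show ?thesis by blast
  qed
  then show ?R using U by blast
next
  assume R: ?R
  define cyl where "cyl x r = Pi\<^sub>E UNIV (\<lambda>j. if \<bar>j\<bar> \<le> r then {x j} else \<Sigma>)" for x :: "int \<Rightarrow> 'a" and r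
  have "openin (full_topology \<Sigma>) (cyl x r)" if "x \<in> X" for x r
    unfolding full_topology_def cyl_def
  proof (rule product_topology_basis)
    show "finite {i. (if \<bar>i\<bar> \<le> r then {x i} else \<Sigma>) \<noteq> topspace (discrete_topology \<Sigma>)}"
      by (rule finite_subset[of _ "{-r..r}"]) auto
  qed (use that X in auto)
  moreover have "U = X \<inter> \<Union> {cyl x r | x r. x \<in> U \<and> X \<inter> cyl x r \<subseteq> U}" (is "_ = X \<inter> \<Union> ?C")
  proof
    show "U \<subseteq> X \<inter> \<Union> ?C"
    proof
      fix x assume x: "x \<in> U"
      then obtain r where r: "\<forall>y\<in>X. (\<forall>j. \<bar>j\<bar> \<le> r \<longrightarrow> y j = x j) \<longrightarrow> y \<in> U"
        using R by blast
      have "y \<in> U" if "y \<in> X" "y \<in> cyl x r" for y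
      proof -
        have "y j = x j" if "\<bar>j\<bar> \<le> r" for j
          using \<open>y \<in> cyl x r\<close> that unfolding cyl_def PiE_iff by (metis UNIV_I singletonD)
        then show ?thesis using r that by blast
      qed
      moreover have "x \<in> cyl x r"
        using x R X by (auto simp: cyl_def PiE_iff)
      ultimately show "x \<in> X \<inter> \<Union> ?C"
        using x R by auto
    qed
  qed auto
  moreover have "x \<in> X" if "x \<in> U" for x using R that by blast
  ultimately have "openin (full_topology \<Sigma>) (\<Union> ?C)"
    by (intro openin_Union) auto
  with \<open>U = X \<inter> \<Union> ?C\<close> show ?L
    by (subst openin_subtopology) (rule exI, rule conjI, assumption, subst Int_commute)
qed

text \<open>The next two lemmas are the Curtis--Hedlund--Lyndon theorem.\<close>

lemma continuous_map_imp_local: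
  assumes "finite \<Sigma>" and cl: "closedin (full_topology \<Sigma>) X"
    and f: "continuous_map (subtopology (full_topology \<Sigma>) X) (subtopology (full_topology \<Sigma>) X) f"
  obtains r where "r \<ge> 0" "\<And>x y. x \<in> X \<Longrightarrow> y \<in> X \<Longrightarrow> (\<And>j. \<bar>j\<bar> \<le> r \<Longrightarrow> x j = y j) \<Longrightarrow> f x 0 = f y 0"
proof -
  let ?T = "subtopology (full_topology \<Sigma>) X"
  have X: "X \<subseteq> full_shift \<Sigma>"
    using closedin_subset[OF cl] by simp
  have "compact_space (full_topology \<Sigma>)"
    using \<open>finite \<Sigma>\<close> by (auto simp: full_topology_def compact_space_product_topology compact_space_discrete_topology)
  then have comp: "compact_space ?T"
    using cl by (simp add: closedin_compact_space compact_space_subtopology)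
  have top: "topspace ?T = X" using X by auto
  \<comment> \<open>The letter \<open>f x 0\<close> depends locally constantly on \<open>x\<close>:
    the points with a given letter at 0 form an open set, and so does their preimage.\<close>
  have ex: "\<exists>r. \<forall>y\<in>X. (\<forall>j. \<bar>j\<bar> \<le> r \<longrightarrow> y j = x j) \<longrightarrow> f y 0 = f x 0" if "x \<in> X" for x
  proof -
    have "openin ?T {y \<in> X. y 0 = f x 0}"
      unfolding openin_subtopology_full_iff[OF X] by (auto intro!: exI[of _ 0])
    then have "openin ?T {y \<in> topspace ?T. f y \<in> {y \<in> X. y 0 = f x 0}}"
      using f unfolding continuous_map_def by blast
    moreover have "x \<in> {y \<in> topspace ?T. f y \<in> {y \<in> X. y 0 = f x 0}}"
      using that f top by (auto simp: continuous_map_def)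
    ultimately show ?thesis
      unfolding openin_subtopology_full_iff[OF X] by blast
  qed
  then obtain r where r: "\<And>x y. \<lbrakk>x \<in> X; y \<in> X; \<And>j. \<bar>j\<bar> \<le> r x \<Longrightarrow> y j = x j\<rbrakk> \<Longrightarrow> f y 0 = f x 0"
    by metis
  define V where "V x = {y \<in> X. \<forall>j. \<bar>j\<bar> \<le> r x \<longrightarrow> y j = x j}" for x
  have opV: "openin ?T (V x)" if "x \<in> X" for x
    unfolding openin_subtopology_full_iff[OF X] V_def by (auto intro!: exI[of _ "r x"])
  have cov: "topspace ?T \<subseteq> \<Union> (V ` X)"
    using top by (auto simp: V_def)
  have "\<exists>\<F>. finite \<F> \<and> \<F> \<subseteq> V ` X \<and> topspace ?T \<subseteq> \<Union> \<F>"
    using comp[unfolded compact_space_def compactin_def, THEN conjunct2, rule_format, of "V ` X"] opV cov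
    by blast
  then obtain F where F: "finite F" "F \<subseteq> X" "X \<subseteq> \<Union> (V ` F)"
    using top by (metis finite_subset_image)
  define R where "R = Max (insert 0 (r ` F))"
  show thesis
  proof
    show "R \<ge> 0" unfolding R_def using F(1) by simp
    fix x y assume xy: "x \<in> X" "y \<in> X" and eq: "\<And>j. \<bar>j\<bar> \<le> R \<Longrightarrow> x j = y j"
    obtain c where c: "c \<in> F" "x \<in> V c"
      using F xy by blast
    have "r c \<le> R"
      unfolding R_def using F(1) c by (intro Max_ge) auto
    \<comment> \<open>Both \<open>x\<close> and \<open>y\<close> are compared with the centre
      \<open>c\<close> from the finite subcover, because the radius \<open>r c\<close> is attached
      to \<open>c\<close>.\<close>
    then have "f y 0 = f c 0"
      using c eq F by (intro r[OF _ xy(2)]) (auto simp: V_def)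
    moreover have "f x 0 = f c 0"
      using c F by (intro r[OF _ xy(1)]) (auto simp: V_def)
    ultimately show "f x 0 = f y 0" by simp
  qed
qed

lemma local_imp_continuous_map:
  assumes X: "X \<subseteq> full_shift \<Sigma>" and f: "f \<in> X \<rightarrow> X"
    and tr: "\<And>k x. x \<in> X \<Longrightarrow> translate k x \<in> X"
    and ftr: "\<And>k x. x \<in> X \<Longrightarrow> f (translate k x) = translate k (f x)"
    and loc: "\<And>x y. \<lbrakk>x \<in> X; y \<in> X; \<And>j. \<bar>j\<bar> \<le> r \<Longrightarrow> x j = y j\<rbrakk> \<Longrightarrow> f x 0 = f y 0"
  shows "continuous_map (subtopology (full_topology \<Sigma>) X) (subtopology (full_topology \<Sigma>) X) f"
proof -
  let ?T = "subtopology (full_topology \<Sigma>) X"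
  have top: "topspace ?T = X" using X by auto
  have "openin ?T {x \<in> X. f x \<in> U}" if U: "openin ?T U" for U
  proof -
    have "\<exists>s. \<forall>y\<in>X. (\<forall>j. \<bar>j\<bar> \<le> s \<longrightarrow> y j = x j) \<longrightarrow> f y \<in> U" if x: "x \<in> X" "f x \<in> U" for x
    proof -
      obtain s where s: "\<forall>y\<in>X. (\<forall>j. \<bar>j\<bar> \<le> s \<longrightarrow> y j = f x j) \<longrightarrow> y \<in> U"
        using U x unfolding openin_subtopology_full_iff[OF X] by blast
      have "f y \<in> U" if y: "y \<in> X" "\<forall>j. \<bar>j\<bar> \<le> s + \<bar>r\<bar> \<longrightarrow> y j = x j" for y
      proof -
        have "f y j = f x j" if "\<bar>j\<bar> \<le> s" for j
        proof -
          have "f (translate j y) 0 = f (translate j x) 0"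
            using x y that by (intro loc tr) (auto simp: translate_apply)
          then show ?thesis using ftr x y by (simp add: translate_apply)
        qed
        then show ?thesis using s f y by blast
      qed
      then show ?thesis by blast
    qed
    then show ?thesis
      unfolding openin_subtopology_full_iff[OF X] by blast
  qed
  then show ?thesis
    unfolding continuous_map_def top using f by blast
qed

section \<open>Automorphisms as invertible local rules\<close>

lemma Aut_mult:
  "f \<in> carrier (Aut \<Sigma> X) \<Longrightarrow> g \<in> carrier (Aut \<Sigma> X) \<Longrightarrow> f \<otimes>\<^bsub>Aut \<Sigma> X\<^esub> g = compose X f g"
  by (simp add: Aut_def BijGroup_def)

lemma Aut_one: "\<one>\<^bsub>Aut \<Sigma> X\<^esub> = (\<lambda>x\<in>X. x)"
  by (simp add: Aut_def BijGroup_def)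

lemma Aut_D:
  assumes "subshift \<Sigma> X" "f \<in> carrier (Aut \<Sigma> X)"
  shows "f \<in> extensional X" "f \<in> X \<rightarrow> X"
    "\<And>k x. x \<in> X \<Longrightarrow> f (translate k x) = translate k (f x)"
  using assms commutes_with_translate[of X f]
  by (auto simp: Aut_def Bij_def bij_betw_def subshift_def)

lemma Aut_local:
  assumes "finite \<Sigma>" "subshift \<Sigma> X" "f \<in> carrier (Aut \<Sigma> X)"
  obtains r where "r \<ge> 0" "\<And>x y. x \<in> X \<Longrightarrow> y \<in> X \<Longrightarrow> (\<And>j. \<bar>j\<bar> \<le> r \<Longrightarrow> x j = y j) \<Longrightarrow> f x 0 = f y 0"
proof (rule continuous_map_imp_local[OF assms(1)])
  show "closedin (full_topology \<Sigma>) X"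
    using assms by (simp add: subshift_def)
  show "continuous_map (subtopology (full_topology \<Sigma>) X) (subtopology (full_topology \<Sigma>) X) f"
    using assms by (auto simp: Aut_def homeomorphic_imp_continuous_map)
qed (use that in blast)

text \<open>The local rules of \<open>f\<close> and of its inverse \<open>g\<close> give continuity
  both ways; that \<open>g\<close> commutes with translations follows from the same property of
  \<open>f\<close>.\<close>

lemma Aut_I:
  assumes sub: "subshift \<Sigma> X" and ext: "f \<in> extensional X" and f: "f \<in> X \<rightarrow> X" and g: "g \<in> X \<rightarrow> X"
    and gf: "\<And>x. x \<in> X \<Longrightarrow> g (f x) = x" and fg: "\<And>x. x \<in> X \<Longrightarrow> f (g x) = x"
    and ftr: "\<And>k x. x \<in> X \<Longrightarrow> f (translate k x) = translate k (f x)"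
    and floc: "\<And>x y. \<lbrakk>x \<in> X; y \<in> X; \<And>j. \<bar>j\<bar> \<le> r \<Longrightarrow> x j = y j\<rbrakk> \<Longrightarrow> f x 0 = f y 0"
    and gloc: "\<And>x y. \<lbrakk>x \<in> X; y \<in> X; \<And>j. \<bar>j\<bar> \<le> s \<Longrightarrow> x j = y j\<rbrakk> \<Longrightarrow> g x 0 = g y 0"
  shows "f \<in> carrier (Aut \<Sigma> X)"
proof -
  have X: "X \<subseteq> full_shift \<Sigma>"
    using sub closedin_subset[of "full_topology \<Sigma>" X] by (auto simp: subshift_def)
  have tr: "translate k x \<in> X" if "x \<in> X" for k x
    using sub closed_under_translate that by (auto simp: subshift_def)
  have gtr: "g (translate k x) = translate k (g x)" if "x \<in> X" for k x
  proof -
    have "g (translate k (f (g x))) = g (f (translate k (g x)))"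
      using ftr g that by (metis PiE)
    then show ?thesis using gf fg tr g that by (metis PiE)
  qed
  have "bij_betw f X X"
    by (rule bij_betwI[where g = g]) (use f g gf fg in auto)
  moreover have "homeomorphic_maps (subtopology (full_topology \<Sigma>) X) (subtopology (full_topology \<Sigma>) X) f g"
    unfolding homeomorphic_maps_def
  proof (intro conjI ballI)
    show "continuous_map (subtopology (full_topology \<Sigma>) X) (subtopology (full_topology \<Sigma>) X) f"
      by (rule local_imp_continuous_map[OF X f tr ftr floc])
    show "continuous_map (subtopology (full_topology \<Sigma>) X) (subtopology (full_topology \<Sigma>) X) g"
      by (rule local_imp_continuous_map[OF X g tr gtr gloc])
  qed (use gf fg in simp_all)
  ultimately show ?thesis
    using ext ftr[of _ 1] unfolding Aut_def Bij_def shift_eq_translate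
    by (auto simp: homeomorphic_map_maps)
qed

section \<open>Overwriting cells\<close>

text \<open>\<open>r\<close> is a common coding radius of the elements of \<open>G\<close>, and \<open>T\<close> a window length that decides
  membership in \<open>X\<close>.\<close>

locale shift_action =
  fixes X :: "(int \<Rightarrow> 'a) set" and G :: "((int \<Rightarrow> 'a) \<Rightarrow> int \<Rightarrow> 'a) set" and r T :: int
  assumes translate_in: "x \<in> X \<Longrightarrow> translate k x \<in> X"
    and G_ext: "g \<in> G \<Longrightarrow> g \<in> extensional X"
    and G_in: "g \<in> G \<Longrightarrow> x \<in> X \<Longrightarrow> g x \<in> X"
    and G_translate: "g \<in> G \<Longrightarrow> x \<in> X \<Longrightarrow> g (translate k x) = translate k (g x)"
    and G_local: "\<lbrakk>g \<in> G; x \<in> X; y \<in> X; \<And>j. \<bar>j\<bar> \<le> r \<Longrightarrow> x j = y j\<rbrakk> \<Longrightarrow> g x 0 = g y 0"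
    and G_one: "(\<lambda>x\<in>X. x) \<in> G"
    and G_compose: "g \<in> G \<Longrightarrow> h \<in> G \<Longrightarrow> compose X g h \<in> G"
    and G_inverse: "g \<in> G \<Longrightarrow> \<exists>h\<in>G. compose X h g = (\<lambda>x\<in>X. x) \<and> compose X g h = (\<lambda>x\<in>X. x)"
    and finite_G: "finite G"
    and r_nonneg: "0 \<le> r" and r_le: "2 * r + 1 \<le> T"
    and glue: "(\<And>i. \<exists>v\<in>X. \<forall>j\<in>{i..<i+T}. u j = v j) \<Longrightarrow> u \<in> X"
begin

text \<open>Comparing two different positions is what lets periodicity pass from \<open>x\<close> to
  \<open>g x\<close>.\<close>

lemma G_local_at:
  assumes "g \<in> G" "x \<in> X" "y \<in> X" "\<And>q. \<bar>q\<bar> \<le> r \<Longrightarrow> x (j + q) = y (k + q)"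
  shows "g x j = g y k"
proof -
  have "g (translate j x) 0 = g (translate k y) 0"
  proof (rule G_local[OF assms(1) translate_in[OF assms(2)] translate_in[OF assms(3)]])
    show "translate j x q = translate k y q" if "\<bar>q\<bar> \<le> r" for q
      using assms(4)[OF that] by (simp only: translate_apply add.commute)
  qed
  then show ?thesis
    unfolding G_translate[OF assms(1,2)] G_translate[OF assms(1,3)] by (simp add: translate_apply)
qed

lemma G_inverse_obtain:
  assumes "g \<in> G"
  obtains h where "h \<in> G" "\<And>x. x \<in> X \<Longrightarrow> h (g x) = x" "\<And>x. x \<in> X \<Longrightarrow> g (h x) = x"
    "compose X h g = (\<lambda>x\<in>X. x)" "compose X g h = (\<lambda>x\<in>X. x)"
proof -
  obtain h where h: "h \<in> G" "compose X h g = (\<lambda>x\<in>X. x)" "compose X g h = (\<lambda>x\<in>X. x)"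
    using G_inverse[OF assms] by blast
  have "h (g x) = x" "g (h x) = x" if "x \<in> X" for x
    using fun_cong[OF h(2), of x] fun_cong[OF h(3), of x] that by (simp_all add: compose_def)
  then show thesis
    by (rule that[OF h(1) _ _ h(2,3)])
qed

end

text \<open>The words have length \<open>n\<close> and differ only on \<open>[lo, hi)\<close>. Rewriting one of them changes its image
  under an element of \<open>G\<close> on \<open>[lo - r, hi + r)\<close> only, so by the bounds on \<open>E\<close> no other cell notices.\<close>

locale cell_words = shift_action X G r T
  for X :: "(int \<Rightarrow> 'a) set" and G r T +
  fixes A :: "'c set" and W :: "'c \<Rightarrow> int \<Rightarrow> 'a" and n lo hi E :: int
  assumes concat: "(\<And>k::int. s k \<in> A) \<Longrightarrow> \<exists>x\<in>X. \<forall>k. \<forall>j\<in>{0..<n}. x (k * n + j) = W (s k) j"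
    and W_outside: "\<lbrakk>a \<in> A; b \<in> A; j \<in> {0..<n}; j \<notin> {lo..<hi}\<rbrakk> \<Longrightarrow> W a j = W b j"
    and W_inj: "\<lbrakk>a \<in> A; b \<in> A; \<And>j. j \<in> {0..<n} \<Longrightarrow> W a j = W b j\<rbrakk> \<Longrightarrow> a = b"
    and separation: "\<lbrakk>x \<in> X; g \<in> G; a \<in> A; b \<in> A; \<And>j. j \<in> {0..<n} \<Longrightarrow> x (i + j) = W a j;
      \<And>j. j \<in> {0..<n} \<Longrightarrow> g x (k + j) = W b j\<rbrakk> \<Longrightarrow> k = i \<and> g = (\<lambda>x\<in>X. x) \<or> E \<le> \<bar>k - i\<bar>"
    and lo_ge: "2 * T \<le> lo" and hi_le: "hi + 2 * T \<le> n" and lo_less_hi: "lo < hi"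
    and E_ge: "hi + 2 * r \<le> E" "n - lo + 2 * r \<le> E"
begin

definition occ :: "(int \<Rightarrow> 'a) \<Rightarrow> int \<Rightarrow> 'c \<Rightarrow> bool"
  where "occ x i a \<longleftrightarrow> (\<forall>j\<in>{0..<n}. x (i + j) = W a j)"

definition cell :: "(int \<Rightarrow> 'a) \<Rightarrow> ((int \<Rightarrow> 'a) \<Rightarrow> int \<Rightarrow> 'a) \<Rightarrow> int \<Rightarrow> bool"
  where "cell x g i \<longleftrightarrow> g \<in> G \<and> (\<exists>a\<in>A. occ (g x) i a)"

definition datum :: "(int \<Rightarrow> 'a) \<Rightarrow> ((int \<Rightarrow> 'a) \<Rightarrow> int \<Rightarrow> 'a) \<Rightarrow> int \<Rightarrow> 'c"
  where "datum x g i = (THE a. a \<in> A \<and> occ (g x) i a)"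

text \<open>The margin is \<open>2 * r\<close> because a cell is rewritten in \<open>g x\<close>, transported back to \<open>x\<close>, and then
  viewed in \<open>h x\<close>; thus \<open>zone x\<close> serves all \<open>h \<in> G\<close> at once.\<close>

definition zone :: "(int \<Rightarrow> 'a) \<Rightarrow> int set"
  where "zone x = {j. \<exists>g i. cell x g i \<and> j \<in> {i + lo - 2 * r..<i + hi + 2 * r}}"

text \<open>A relation instead of a function: the identity, compositions, translates and images
  under \<open>G\<close> can each be checked against it and then identified by uniqueness. The last
  clause speaks of all \<open>h\<close> at once, so that no image acquires a new cell.\<close>

definition overwritten ::
    "(int \<Rightarrow> 'a) \<Rightarrow> (((int \<Rightarrow> 'a) \<Rightarrow> int \<Rightarrow> 'a) \<Rightarrow> int \<Rightarrow> 'c) \<Rightarrow> (int \<Rightarrow> 'a) \<Rightarrow> bool"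
  where "overwritten x d x' \<longleftrightarrow> x' \<in> X \<and> (\<forall>g i. cell x g i \<longrightarrow> d g i \<in> A \<and> occ (g x') i (d g i)) \<and>
    (\<forall>h\<in>G. \<forall>j. j \<notin> zone x \<longrightarrow> h x' j = h x j)"

lemma bounds: "0 \<le> r" "2 * r + 1 \<le> T" "2 * T \<le> lo" "hi + 2 * T \<le> n" "lo < hi"
  "hi + 2 * r \<le> E" "n - lo + 2 * r \<le> E"
  using r_nonneg r_le lo_ge hi_le lo_less_hi E_ge by auto

lemma occ_unique: "\<lbrakk>a \<in> A; b \<in> A; occ x i a; occ x i b\<rbrakk> \<Longrightarrow> a = b"
  using W_inj[of a b] unfolding occ_def by metis

lemma datum_eq: "\<lbrakk>a \<in> A; occ (g x) i a\<rbrakk> \<Longrightarrow> datum x g i = a"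
  unfolding datum_def using occ_unique by (intro the_equality) blast+

lemma cellD:
  assumes "cell x g i"
  shows "g \<in> G" "datum x g i \<in> A" "occ (g x) i (datum x g i)"
  using assms datum_eq unfolding cell_def by metis+

text \<open>\<open>separation\<close> is applied to the point \<open>g x\<close> and to
  \<open>h\<close> after the inverse of \<open>g\<close>, which takes \<open>g x\<close> to
  \<open>h x\<close>.\<close>

lemma cells_apart:
  assumes x: "x \<in> X" and c: "cell x g i" "cell x h k"
  shows "g = h \<and> i = k \<or> E \<le> \<bar>k - i\<bar>"
proof -
  have gh: "g \<in> G" "h \<in> G" using c cellD by blast+
  obtain g' where g': "g' \<in> G" "\<And>x. x \<in> X \<Longrightarrow> g' (g x) = x" "compose X g' g = (\<lambda>x\<in>X. x)"
    using G_inverse_obtain[OF gh(1)] by metis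
  have gx: "g x \<in> X" using G_in gh x by blast
  have eq: "compose X h g' (g x) = h x"
    using gx g'(2)[OF x] by (simp add: compose_def)
  have "k = i \<and> compose X h g' = (\<lambda>x\<in>X. x) \<or> E \<le> \<bar>k - i\<bar>"
  proof (rule separation[OF gx G_compose[OF gh(2) g'(1)]])
    show "datum x g i \<in> A" "datum x h k \<in> A" using c cellD by blast+
    show "g x (i + j) = W (datum x g i) j" "compose X h g' (g x) (k + j) = W (datum x h k) j"
      if "j \<in> {0..<n}" for j
      using cellD(3)[OF c(1)] cellD(3)[OF c(2)] that unfolding occ_def eq by blast+
  qed
  moreover have "g = h" if 1: "compose X h g' = (\<lambda>x\<in>X. x)"
  proof (rule extensionalityI)
    show "g \<in> extensional X" "h \<in> extensional X" using G_ext gh by auto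
    fix y assume y: "y \<in> X"
    show "g y = h y"
      using fun_cong[OF 1, of "g y"] G_in[OF gh(1) y] g'(2)[OF y] by (simp add: compose_def)
  qed
  ultimately show ?thesis by blast
qed

text \<open>The bound \<open>n - lo + 2 * r \<le> E\<close> serves if the cell at \<open>k\<close>
  lies to the right of the one at \<open>i\<close>, and \<open>hi + 2 * r \<le> E\<close> if it lies
  to the left.\<close>

lemma cell_zone_apart:
  assumes "x \<in> X" "cell x g i" "cell x h k" "(g, i) \<noteq> (h, k)"
    and "i \<le> j" "j < i + n" "j \<in> {k + lo - 2 * r..<k + hi + 2 * r}"
  shows False
  using cells_apart[OF assms(1-3)] assms(4-) bounds by (auto simp: abs_if split: if_splits)

text \<open>A window of length \<open>T\<close> either lies inside the cell, where it is a window of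
  a legal word, or reaches beyond it. In the latter case the margins keep it off the part where the
  words differ, so it is unchanged.\<close>

lemma replace_word:
  assumes x: "x \<in> X" and a: "a \<in> A" "occ x i a" and b: "b \<in> A"
  shows "(\<lambda>j. if j \<in> {i..<i + n} then W b (j - i) else x j) \<in> X" (is "?u \<in> X")
proof (rule glue)
  fix k
  obtain v0 where v0: "v0 \<in> X" "\<And>j. j \<in> {0..<n} \<Longrightarrow> v0 j = W b j"
    using concat[of "\<lambda>_. b"] b by (metis mult_zero_left add_0)
  show "\<exists>v\<in>X. \<forall>j\<in>{k..<k + T}. ?u j = v j"
  proof (cases "i \<le> k \<and> k + T \<le> i + n")
    case True
    then have "\<forall>j\<in>{k..<k + T}. ?u j = translate (- i) v0 j"
      using v0(2) by (auto simp: translate_apply)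
    then show ?thesis using translate_in[OF v0(1)] by blast
  next
    case False
    have "?u j = x j" if j: "j \<in> {k..<k + T}" for j
    proof (cases "j \<in> {i..<i + n}")
      case True
      then have "j - i \<notin> {lo..<hi}" using False j bounds by auto
      then have "W b (j - i) = W a (j - i)" using True a b by (intro W_outside) auto
      also have "\<dots> = x j"
        using bspec[OF a(2)[unfolded occ_def], of "j - i"] True by auto
      finally show ?thesis using True by simp
    next
      case False
      then show ?thesis by auto
    qed
    then show ?thesis using x by blast
  qed
qed

text \<open>Each cell is rewritten alone in \<open>g x\<close> and carried back to \<open>x\<close>.
  The changes caused by distinct cells are at least \<open>T\<close> apart, so a window of length
  \<open>T\<close> meets at most one of them and they can be glued.\<close>

lemma overwritten_exists:
  assumes x: "x \<in> X" and d: "\<And>g i. cell x g i \<Longrightarrow> d g i \<in> A"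
  shows "\<exists>x'. overwritten x d x'"
proof -
  define inv' where "inv' g = (SOME h. h \<in> G \<and> (\<forall>x\<in>X. h (g x) = x \<and> g (h x) = x))" for g
  have inv': "inv' g \<in> G" "\<And>x. x \<in> X \<Longrightarrow> inv' g (g x) = x" "\<And>x. x \<in> X \<Longrightarrow> g (inv' g x) = x" if "g \<in> G" for g
  proof -
    have "\<exists>h. h \<in> G \<and> (\<forall>x\<in>X. h (g x) = x \<and> g (h x) = x)"
      using G_inverse_obtain[OF that] by metis
    from someI_ex[OF this] show "inv' g \<in> G" "\<And>x. x \<in> X \<Longrightarrow> inv' g (g x) = x" "\<And>x. x \<in> X \<Longrightarrow> g (inv' g x) = x"
      unfolding inv'_def by blast+
  qed
  define u where "u g i = (\<lambda>j. if j \<in> {i..<i + n} then W (d g i) (j - i) else g x j)" for g i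
  define y where "y g i = inv' g (u g i)" for g i
  have u: "u g i \<in> X" if "cell x g i" for g i
    unfolding u_def
    by (rule replace_word[OF G_in[OF cellD(1)[OF that] x] cellD(2,3)[OF that] d[OF that]])
  have y: "y g i \<in> X" "g (y g i) = u g i" if "cell x g i" for g i
    unfolding y_def using u inv' cellD(1) G_in that by blast+
  have u_eq: "u g i j = g x j" if c: "cell x g i" and j: "j \<notin> {i + lo..<i + hi}" for g i j
  proof (cases "j \<in> {i..<i + n}")
    case True
    have "W (d g i) (j - i) = W (datum x g i) (j - i)"
      using True j c d cellD by (intro W_outside) auto
    also have "\<dots> = g x (i + (j - i))"
      using bspec[OF cellD(3)[OF c, unfolded occ_def], of "j - i"] True by auto
    finally show ?thesis using True by (simp add: u_def)
  next
    case False
    then show ?thesis unfolding u_def by (rule if_not_P)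
  qed
  have y_eq: "y g i j = x j" if c: "cell x g i" and j: "j \<notin> {i + lo - r..<i + hi + r}" for g i j
  proof -
    have g: "g \<in> G" using c cellD(1) by blast
    have "inv' g (u g i) j = inv' g (g x) j"
    proof (rule G_local_at[OF inv'(1)[OF g] u[OF c] G_in[OF g x]])
      show "u g i (j + q) = g x (j + q)" if "\<bar>q\<bar> \<le> r" for q
        using j that by (intro u_eq[OF c]) auto
    qed
    then have "y g i j = inv' g (g x) j"
      by (simp add: y_def)
    then show ?thesis using inv' cellD(1)[OF c] x by simp
  qed
  define near where "near g i j \<longleftrightarrow> cell x g i \<and> j \<in> {i + lo - r..<i + hi + r}" for g i j
  have near_unique: "g = h \<and> i = k" if "near g i j" "near h k l" "\<bar>j - l\<bar> < T" for g h i k j l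
    using cells_apart[OF x, of g i h k] that bounds unfolding near_def
    by (auto simp: abs_if split: if_splits)
  define x' where "x' j = (if \<exists>g i. near g i j then (THE v. \<exists>g i. near g i j \<and> v = y g i j) else x j)" for j
  have T: "0 < T" using bounds by simp
  have x'_near: "x' j = y g i j" if "near g i j" for g i j
  proof -
    have "(THE v. \<exists>g i. near g i j \<and> v = y g i j) = y g i j"
      using that near_unique[of _ _ j _ _ j] T by (intro the_equality) auto
    then show ?thesis using that unfolding x'_def by auto
  qed
  have x'_far: "x' j = x j" if "\<And>g i. \<not> near g i j" for j
    using that unfolding x'_def by auto
  \<comment> \<open>Where no other cell interferes, \<open>x'\<close> is \<open>y g i\<close>, also
    at positions which the rewriting leaves alone; hence whole windows can be compared.\<close>
  have x'_own: "x' j = y g i j" if "cell x g i" "\<And>h k. near h k j \<Longrightarrow> h = g \<and> k = i" for g i j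
  proof (cases "near g i j")
    case True
    then show ?thesis by (rule x'_near)
  next
    case False
    then have "x' j = x j" using that(2) by (intro x'_far) blast
    moreover have "y g i j = x j" using False that(1) y_eq by (auto simp: near_def)
    ultimately show ?thesis by simp
  qed
  have "x' \<in> X"
  proof (rule glue)
    fix c
    show "\<exists>v\<in>X. \<forall>j\<in>{c..<c + T}. x' j = v j"
    proof (cases "\<exists>g i. \<exists>j\<in>{c..<c + T}. near g i j")
      case True
      then obtain g i l where l: "l \<in> {c..<c + T}" "near g i l" by blast
      then have c: "cell x g i" by (simp add: near_def)
      have "x' j = y g i j" if "j \<in> {c..<c + T}" for j
        using near_unique[OF l(2)] l(1) that by (intro x'_own[OF c]) fastforce
      then show ?thesis using y[OF c] by blast
    next
      case False
      then show ?thesis using x x'_far by blast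
    qed
  qed
  moreover have "occ (g x') i (d g i)" if c: "cell x g i" for g i
    unfolding occ_def
  proof
    fix j assume j: "j \<in> {0..<n}"
    have "g x' (i + j) = g (y g i) (i + j)"
    proof (rule G_local_at[where g = g])
      show "x' (i + j + q) = y g i (i + j + q)" if "\<bar>q\<bar> \<le> r" for q
      proof (rule x'_own[OF c])
        fix h k assume nr: "near h k (i + j + q)"
        then have "cell x h k" "i + j \<in> {k + lo - 2 * r..<k + hi + 2 * r}"
          using that by (auto simp: near_def)
        then show "h = g \<and> k = i"
          using cell_zone_apart[OF x c, of h k "i + j"] j by auto
      qed
    qed (use c cellD \<open>x' \<in> X\<close> y in auto)
    then show "g x' (i + j) = W (d g i) j"
      using y[OF c] j by (simp add: u_def)
  qed
  moreover have "h x' j = h x j" if "h \<in> G" "j \<notin> zone x" for h j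
  proof (rule G_local_at[where g = h])
    show "x' (j + q) = x (j + q)" if "\<bar>q\<bar> \<le> r" for q
    proof (rule x'_far)
      fix g i show "\<not> near g i (j + q)"
        using \<open>j \<notin> zone x\<close> that unfolding zone_def near_def by fastforce
    qed
  qed (use that x \<open>x' \<in> X\<close> in auto)
  ultimately have "overwritten x d x'"
    using d unfolding overwritten_def by blast
  then show ?thesis by blast
qed

text \<open>The inverse of \<open>g\<close> has radius \<open>r\<close>, and the zone of the cell
  widened by \<open>r\<close> still lies inside the word.\<close>

lemma determined_in_cell:
  assumes g: "g \<in> G" and xy: "x \<in> X" "y \<in> X" "occ (g x) i a" "occ (g y) i a"
    and j: "j \<in> {i + lo - 2 * r..<i + hi + 2 * r}"
  shows "x j = y j"
proof -
  obtain h where h: "h \<in> G" "\<And>x. x \<in> X \<Longrightarrow> h (g x) = x"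
    using G_inverse_obtain[OF g] by metis
  have "h (g x) j = h (g y) j"
  proof (rule G_local_at[where g = h])
    fix q :: int assume "\<bar>q\<bar> \<le> r"
    then have "j + q - i \<in> {0..<n}" using j bounds by auto
    then have "g x (i + (j + q - i)) = g y (i + (j + q - i))"
      using xy unfolding occ_def by metis
    then show "g x (j + q) = g y (j + q)" by simp
  qed (use G_in g h xy in auto)
  then show ?thesis using h xy by simp
qed

lemma overwritten_unique:
  assumes x: "x \<in> X" and o: "overwritten x d y" "overwritten x d z"
  shows "y = z"
proof
  fix j
  show "y j = z j"
  proof (cases "j \<in> zone x")
    case True
    then obtain g i where c: "cell x g i" and j: "j \<in> {i + lo - 2 * r..<i + hi + 2 * r}"
      by (auto simp: zone_def)
    show ?thesis
      using o c by (intro determined_in_cell[OF cellD(1)[OF c] _ _ _ _ j]) (auto simp: overwritten_def)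
  next
    case False
    have "(\<lambda>x\<in>X. x) y j = (\<lambda>x\<in>X. x) z j"
      using o False G_one unfolding overwritten_def by metis
    then show ?thesis using o by (simp add: overwritten_def)
  qed
qed

section \<open>What overwriting preserves, and its symmetries\<close>

lemma overwritten_datum:
  assumes "overwritten x d y" "cell x g i"
  shows "datum y g i = d g i"
  using assms by (intro datum_eq) (auto simp: overwritten_def)

text \<open>Old cells persist in \<open>y\<close>, so a cell of \<open>y\<close> that is not among
  them avoids the zone. There \<open>g y\<close> and \<open>g x\<close> agree, hence it was a cell
  of \<open>x\<close> already.\<close>

lemma overwritten_cell:
  assumes x: "x \<in> X" and o: "overwritten x d y"
  shows "cell y g i \<longleftrightarrow> cell x g i"
proof
  assume "cell x g i"
  then show "cell y g i" using o cellD(1) by (auto simp: overwritten_def cell_def)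
next
  have y: "y \<in> X" using o by (simp add: overwritten_def)
  have mono: "cell y h k" if "cell x h k" for h k
    using that o cellD(1) by (auto simp: overwritten_def cell_def)
  assume c: "cell y g i"
  show "cell x g i"
  proof (rule ccontr)
    assume nc: "\<not> cell x g i"
    have "g x (i + j) = g y (i + j)" if j: "j \<in> {0..<n}" for j
    proof -
      have "i + j \<notin> zone x"
        using cell_zone_apart[OF y c mono, of _ _ "i + j"] nc j unfolding zone_def by auto
      then show ?thesis using o cellD(1)[OF c] unfolding overwritten_def by metis
    qed
    then have "occ (g x) i (datum y g i)"
      using cellD(3)[OF c] by (simp add: occ_def)
    then show False using nc cellD[OF c] by (auto simp: cell_def)
  qed
qed

lemma overwritten_zone:
  assumes "x \<in> X" "overwritten x d y"
  shows "zone y = zone x"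
  using overwritten_cell[OF assms] by (simp add: zone_def)

text \<open>Cells and zone are the same for \<open>x\<close> and \<open>y\<close>, and the second
  overwriting replaces all data written by the first.\<close>

lemma overwritten_trans:
  assumes x: "x \<in> X" and o: "overwritten x d y" "overwritten y e z"
  shows "overwritten x e z"
  using o overwritten_cell[OF x o(1)] overwritten_zone[OF x o(1)] by (auto simp: overwritten_def)

lemma overwritten_self: "x \<in> X \<Longrightarrow> overwritten x (datum x) x"
  using cellD by (auto simp: overwritten_def)

lemma overwritten_cong:
  "\<lbrakk>overwritten x d y; \<And>g i. cell x g i \<Longrightarrow> d g i = e g i\<rbrakk> \<Longrightarrow> overwritten x e y"
  by (auto simp: overwritten_def)

lemma cell_translate:
  assumes "x \<in> X" shows "cell (translate k x) g i \<longleftrightarrow> cell x g (i + k)"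
  using G_translate[OF _ assms] by (auto simp: cell_def occ_def translate_apply add_ac)

lemma datum_translate:
  assumes "x \<in> X" "g \<in> G" shows "datum (translate k x) g i = datum x g (i + k)"
  using G_translate[OF assms(2,1)] by (simp add: datum_def occ_def translate_apply add_ac)

lemma overwritten_translate:
  assumes x: "x \<in> X" and o: "overwritten x d y"
  shows "overwritten (translate k x) (\<lambda>g i. d g (i + k)) (translate k y)"
proof -
  have y: "y \<in> X" using o by (simp add: overwritten_def)
  have z: "j \<in> zone (translate k x) \<longleftrightarrow> j + k \<in> zone x" for j
  proof
    assume "j \<in> zone (translate k x)"
    then show "j + k \<in> zone x"
      unfolding zone_def cell_translate[OF x] by force
  next
    assume "j + k \<in> zone x"
    then obtain g i where "cell x g ((i - k) + k)" "j \<in> {i - k + lo - 2 * r..<i - k + hi + 2 * r}"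
      by (auto simp: zone_def)
    then show "j \<in> zone (translate k x)"
      unfolding zone_def cell_translate[OF x] by blast
  qed
  show ?thesis
    using o y translate_in[OF y] cellD(1)
    by (auto simp: overwritten_def cell_translate[OF x] z G_translate[OF _ x] G_translate[OF _ y]
        translate_apply occ_def add_ac)
qed

lemma cell_action:
  assumes "x \<in> X" "h \<in> G" "g \<in> G" shows "cell (h x) g i \<longleftrightarrow> cell x (compose X g h) i"
  using assms G_compose by (auto simp: cell_def compose_def)

lemma datum_action:
  assumes "x \<in> X" shows "datum (h x) g i = datum x (compose X g h) i"
  using assms by (simp add: datum_def compose_def)

text \<open>A cell of type \<open>g\<close> in \<open>h x\<close> is one of type
  \<open>compose X g h\<close> in \<open>x\<close>. Right multiplication by \<open>h\<close>
  permutes \<open>G\<close>, so the zone is unchanged.\<close>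

lemma overwritten_action:
  assumes x: "x \<in> X" and h: "h \<in> G" and o: "overwritten x d y"
  shows "overwritten (h x) (\<lambda>g i. d (compose X g h) i) (h y)"
proof -
  have y: "y \<in> X" using o by (simp add: overwritten_def)
  have z: "zone (h x) = zone x"
  proof -
    obtain h' where h': "h' \<in> G" "\<And>x. x \<in> X \<Longrightarrow> h' (h x) = x" 
      using G_inverse_obtain[OF h] by metis
    have "\<exists>g'. cell (h x) g' i" if c: "cell x g i" for g i
    proof -
      have "cell (h x) (compose X g h') i"
        using c cellD(1)[OF c] h' G_compose G_in[OF h x] x by (auto simp: cell_def compose_def)
      then show ?thesis by blast
    qed
    then have "(\<exists>g. cell (h x) g i) \<longleftrightarrow> (\<exists>g. cell x g i)" for i
      using cell_action[OF x h] cellD(1) by blast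
    then show ?thesis unfolding zone_def by blast
  qed
  have comp: "g (h v) = compose X g h v" if "v \<in> X" for g v
    using that by (simp add: compose_def)
  show ?thesis
    unfolding overwritten_def z
  proof (intro conjI allI impI ballI)
    show "h y \<in> X" by (rule G_in[OF h y])
    fix g i assume "cell (h x) g i"
    then have "cell x (compose X g h) i"
      using cell_action[OF x h] cellD(1) by blast
    then show "d (compose X g h) i \<in> A" "occ (g (h y)) i (d (compose X g h) i)"
      using o unfolding overwritten_def comp[OF y, of g] by blast+
  next
    fix g j assume "g \<in> G" "j \<notin> zone x"
    then have "compose X g h y j = compose X g h x j"
      using o G_compose[OF _ h] unfolding overwritten_def by blast
    then show "g (h y) j = g (h x) j"
      by (simp add: comp[OF x, of g] comp[OF y, of g])
  qed
qed

end

section \<open>Conveyor belts\<close>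

text \<open>A state is a cell position with a track, \<open>True\<close> being the one read to the right. Positions
  outside \<open>C\<close> are fixed in order to make the step a permutation, whose inverse is its conjugate
  by \<open>flip\<close>.\<close>

fun flip :: "int \<times> bool \<Rightarrow> int \<times> bool"
  where "flip (i, t) = (i, \<not> t)"

fun belt_step :: "int \<Rightarrow> int set \<Rightarrow> int \<times> bool \<Rightarrow> int \<times> bool" where
  "belt_step n C (i, t) =
    (if i \<notin> C then (i, t)
     else if t then (if i + n \<in> C then (i + n, True) else (i, False))
     else (if i - n \<in> C then (i - n, False) else (i, True)))"

definition belt_walk :: "int \<Rightarrow> int set \<Rightarrow> int \<times> bool \<Rightarrow> int \<Rightarrow> int \<times> bool" where
  "belt_walk n C s k =
    (if 0 \<le> k then (belt_step n C ^^ nat k) s else flip ((belt_step n C ^^ nat (- k)) (flip s)))"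

lemma flip_flip [simp]: "flip (flip s) = s"
  by (cases s) simp

lemma fst_flip [simp]: "fst (flip s) = fst s"
  by (cases s) simp

lemma flip_belt_step: "flip (belt_step n C (flip (belt_step n C s))) = s"
  by (cases s) auto

lemma belt_walk_0 [simp]: "belt_walk n C s 0 = s"
  by (simp add: belt_walk_def)

lemma belt_walk_Suc: "belt_walk n C s (k + 1) = belt_step n C (belt_walk n C s k)"
proof (cases "0 \<le> k")
  case True
  then show ?thesis by (simp add: belt_walk_def nat_add_distrib)
next
  case False
  define m where "m = nat (- k - 1)"
  have m: "nat (- k) = Suc m" "k + 1 = - int m" using False by (auto simp: m_def)
  define v where "v = (belt_step n C ^^ m) (flip s)"
  have "belt_walk n C s (k + 1) = flip v"
    unfolding m v_def belt_walk_def by simp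
  moreover have "belt_walk n C s k = flip (belt_step n C v)"
    using False m by (simp add: belt_walk_def v_def)
  moreover have "flip v = belt_step n C (flip (belt_step n C v))"
    using flip_belt_step[of n C v] by (metis flip_flip)
  ultimately show ?thesis by simp
qed

lemma belt_walk_pred: "belt_walk n C s (k - 1) = flip (belt_step n C (flip (belt_walk n C s k)))"
  using belt_walk_Suc[of n C s "k - 1"] flip_belt_step[of n C "belt_walk n C s (k - 1)"]
  by (simp del: belt_step.simps flip.simps)

lemma belt_walk_add: "belt_walk n C (belt_walk n C s l) k = belt_walk n C s (l + k)"
proof (induction k rule: int_induct[where k = 0])
  case base
  show ?case by simp
next
  case (step1 i)
  then show ?case
    using belt_walk_Suc[of n C "belt_walk n C s l" i] belt_walk_Suc[of n C s "l + i"]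
    by (simp add: add.assoc)
next
  case (step2 i)
  then show ?case
    using belt_walk_pred[of n C "belt_walk n C s l" i] belt_walk_pred[of n C s "l + i"]
    by (simp add: add_diff_eq)
qed

lemma belt_walk_in:
  assumes "fst s \<in> C" shows "fst (belt_walk n C s k) \<in> C"
proof -
  have "fst (belt_step n C s) \<in> C" if "fst s \<in> C" for s
    using that by (cases s) auto
  then have "fst ((belt_step n C ^^ m) s) \<in> C" if "fst s \<in> C" for s m
    using that by (induction m) auto
  then show ?thesis
    using assms by (simp add: belt_walk_def)
qed

lemma belt_walk_translate:
  "belt_walk n {i. i + c \<in> C} (i, t) k = apfst (\<lambda>i. i - c) (belt_walk n C (i + c, t) k)"
proof -
  have step: "belt_step n {i. i + c \<in> C} (apfst (\<lambda>i. i - c) s) = apfst (\<lambda>i. i - c) (belt_step n C s)" for s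
    by (cases s) (auto simp: algebra_simps)
  have "(belt_step n {i. i + c \<in> C} ^^ m) (apfst (\<lambda>i. i - c) s) =
      apfst (\<lambda>i. i - c) ((belt_step n C ^^ m) s)" for m s
    by (induction m) (simp_all add: step)
  from this[of _ "(i + c, _)"]
  have pow: "(belt_step n {i. i + c \<in> C} ^^ m) (i, t) = apfst (\<lambda>i. i - c) ((belt_step n C ^^ m) (i + c, t))" for m t
    by simp
  have "flip (apfst (\<lambda>i. i - c) s) = apfst (\<lambda>i. i - c) (flip s)" for s
    by (cases s) auto
  then show ?thesis
    by (simp add: belt_walk_def pow)
qed

text \<open>A step moves by at most \<open>n\<close> but also inspects the position \<open>n\<close>
  further on, hence the extra 1 in the window of the hypothesis.\<close>

lemma belt_walk_local:
  assumes n: "0 \<le> n" and C: "\<And>p. \<bar>p - i\<bar> \<le> (\<bar>k\<bar> + 1) * n \<Longrightarrow> p \<in> C \<longleftrightarrow> p \<in> D"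
  shows "belt_walk n C (i, t) k = belt_walk n D (i, t) k"
    and "\<bar>fst (belt_walk n C (i, t) k) - i\<bar> \<le> \<bar>k\<bar> * n"
proof -
  have *: "\<bar>fst ((belt_step n C ^^ m) (i, t)) - i\<bar> \<le> int m * n \<and>
      (int m \<le> \<bar>k\<bar> \<longrightarrow> (belt_step n C ^^ m) (i, t) = (belt_step n D ^^ m) (i, t))" for m t
  proof (induction m)
    case (Suc m)
    obtain p b where pb: "(belt_step n C ^^ m) (i, t) = (p, b)" by fastforce
    have p: "\<bar>p - i\<bar> \<le> int m * n" using Suc pb by simp
    have 1: "\<bar>fst (belt_step n C (p, b)) - i\<bar> \<le> int m * n + n"
      using p n by auto
    have 2: "belt_step n C (p, b) = belt_step n D (p, b)" if "int (Suc m) \<le> \<bar>k\<bar>"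
    proof -
      have "int m * n + n \<le> (\<bar>k\<bar> + 1) * n"
        using mult_right_mono[of "int m + 1" "\<bar>k\<bar> + 1" n] that n by (simp add: distrib_right)
      then have "p \<in> C \<longleftrightarrow> p \<in> D" "p + n \<in> C \<longleftrightarrow> p + n \<in> D" "p - n \<in> C \<longleftrightarrow> p - n \<in> D"
        using p n by (auto intro!: C)
      then show ?thesis by auto
    qed
    have "\<bar>fst ((belt_step n C ^^ Suc m) (i, t)) - i\<bar> \<le> int (Suc m) * n"
      using 1 pb by (simp add: distrib_right)
    moreover have "(belt_step n C ^^ Suc m) (i, t) = (belt_step n D ^^ Suc m) (i, t)" if "int (Suc m) \<le> \<bar>k\<bar>"
    proof -
      have "(belt_step n D ^^ m) (i, t) = (p, b)"
        using Suc that pb by simp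
      then show ?thesis
        using 2[OF that] pb by (simp del: belt_step.simps)
    qed
    ultimately show ?case by blast
  qed simp
  \<comment> \<open>A backward walk starts from the flipped state, hence
    \<open>\<not> t\<close>.\<close>
  show "belt_walk n C (i, t) k = belt_walk n D (i, t) k"
    using *[of "nat k" t] *[of "nat (- k)" "\<not> t"] by (auto simp: belt_walk_def)
  show "\<bar>fst (belt_walk n C (i, t) k) - i\<bar> \<le> \<bar>k\<bar> * n"
    using *[of "nat k" t] *[of "nat (- k)" "\<not> t"] by (auto simp: belt_walk_def)
qed

text \<open>A bi-infinite run has no turning points, so its upper track is a belt of its own. Such
  runs will distinguish different automorphisms.\<close>

lemma belt_walk_full: "belt_walk n (range (\<lambda>k. k * n)) (0, True) k = (k * n, True)"
proof (induction k rule: int_induct[where k = 0])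
  case base
  show ?case by simp
next
  case (step1 i)
  have "i * n + n = (i + 1) * n" by (simp add: distrib_right)
  then show ?case
    unfolding belt_walk_Suc using step1 by (simp del: distrib_right_numeral) (metis rangeI)
next
  case (step2 i)
  have "i * n - n = (i - 1) * n" by (simp add: left_diff_distrib)
  then show ?case
    unfolding belt_walk_pred using step2 by simp (metis rangeI)
qed

section \<open>The action along the belts\<close>

lemma translate_in_full_shift: "x \<in> full_shift \<Gamma> \<Longrightarrow> translate k x \<in> full_shift \<Gamma>"
  by (auto simp: translate_apply)

locale belts = cell_words X G r T "\<Gamma> \<times> \<Gamma>" W n lo hi E
  for X :: "(int \<Rightarrow> 'a) set" and G r T and \<Gamma> :: "'b set" and W n lo hi E
begin

text \<open>Shift-equivariance carries the algebra of the belts; continuity enters in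
  \<open>belt_map_local\<close>, as a local rule.\<close>

definition endo :: "((int \<Rightarrow> 'b) \<Rightarrow> int \<Rightarrow> 'b) \<Rightarrow> bool" where
  "endo f \<longleftrightarrow> f \<in> full_shift \<Gamma> \<rightarrow> full_shift \<Gamma> \<and>
    (\<forall>x\<in>full_shift \<Gamma>. \<forall>k. f (translate k x) = translate k (f x))"

definition belt :: "(int \<Rightarrow> 'a) \<Rightarrow> ((int \<Rightarrow> 'a) \<Rightarrow> int \<Rightarrow> 'a) \<Rightarrow> int \<times> bool \<Rightarrow> int \<Rightarrow> 'b" where
  "belt x g s k = (case belt_walk n {i. cell x g i} s k of
     (p, b) \<Rightarrow> (if b then fst else snd) (datum x g p))"

definition updated where
  "updated f x g i = (f (belt x g (i, True)) 0, f (belt x g (i, False)) 0)"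

text \<open>For \<open>f\<close> with \<open>endo f\<close> the chosen point exists and is unique.
  The restriction to \<open>X\<close> matches the extensionality of the elements of
  \<open>Aut\<close>.\<close>

definition belt_map where
  "belt_map f = (\<lambda>x\<in>X. SOME y. overwritten x (updated f x) y)"

lemma belt_in:
  assumes "cell x g (fst s)" shows "belt x g s \<in> full_shift \<Gamma>"
proof
  fix k
  obtain p b where pb: "belt_walk n {i. cell x g i} s k = (p, b)" by fastforce
  then have "cell x g p"
    using belt_walk_in[of s "{i. cell x g i}" n k] assms by simp
  then show "belt x g s k \<in> \<Gamma>"
    using cellD(2) pb by (auto simp: belt_def mem_Times_iff)
qed

lemma endo_value: "endo f \<Longrightarrow> y \<in> full_shift \<Gamma> \<Longrightarrow> f y k \<in> \<Gamma>"
  unfolding endo_def by (drule conjunct1, drule (1) funcset_mem, drule funcset_mem) auto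

lemma updated_in: "\<lbrakk>endo f; cell x g i\<rbrakk> \<Longrightarrow> updated f x g i \<in> \<Gamma> \<times> \<Gamma>"
  using endo_value[OF _ belt_in, of f x g "(i, _)"] by (simp add: updated_def)

lemma overwritten_belt_map:
  assumes "endo f" "x \<in> X" shows "overwritten x (updated f x) (belt_map f x)"
  unfolding belt_map_def restrict_apply'[OF assms(2)]
  by (rule someI_ex[OF overwritten_exists[OF assms(2) updated_in[OF assms(1)]]])

text \<open>The identities for belt maps below all come from this: the candidate value only has to
  carry the right data.\<close>

lemma belt_map_eqI:
  "\<lbrakk>endo f; x \<in> X; overwritten x (updated f x) y\<rbrakk> \<Longrightarrow> belt_map f x = y"
  by (rule overwritten_unique[OF _ overwritten_belt_map])

lemma belt_map_in: "endo f \<Longrightarrow> belt_map f \<in> X \<rightarrow> X"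
  using overwritten_belt_map unfolding overwritten_def by (intro funcsetI) blast

lemma belt_map_extensional: "belt_map f \<in> extensional X"
  by (simp add: belt_map_def)

text \<open>All states on one belt see the same sequence up to translation; this makes the separate
  updates of the cells fit together.\<close>

lemma belt_belt_walk: "belt x g (belt_walk n {i. cell x g i} s k) = translate k (belt x g s)"
  by (rule ext) (simp only: belt_def belt_walk_add translate_apply add.commute[of k])

text \<open>Each state contributes one letter; since \<open>f\<close> commutes with translations,
  the letters written along a belt form the whole image sequence.\<close>

lemma belt_overwritten:
  assumes f: "endo f" and x: "x \<in> X" and o: "overwritten x (updated f x) y" and c: "cell x g (fst s)"
  shows "belt y g s = f (belt x g s)"
proof
  fix k
  let ?C = "{i. cell x g i}"
  obtain p b where pb: "belt_walk n ?C s k = (p, b)" by fastforce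
  have C: "{i. cell y g i} = ?C" using overwritten_cell[OF x o] by simp
  have p: "cell x g p"
    using belt_walk_in[of s ?C n k] c pb by simp
  have "belt y g s k = (if b then fst else snd) (updated f x g p)"
    unfolding belt_def C pb using overwritten_datum[OF o p] by simp
  also have "\<dots> = f (belt x g (p, b)) 0"
    by (simp add: updated_def)
  also have "belt x g (p, b) = translate k (belt x g s)"
    using belt_belt_walk[of x g s k] pb by simp
  also have "f (translate k (belt x g s)) 0 = f (belt x g s) k"
    using f belt_in[OF c] unfolding endo_def by (simp add: translate_apply)
  finally show "belt y g s k = f (belt x g s) k" .
qed

lemma belt_map_compose:
  assumes f: "endo f" "endo h" and x: "x \<in> X"
  shows "belt_map (compose (full_shift \<Gamma>) f h) x = belt_map f (belt_map h x)"
proof (rule belt_map_eqI)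
  show "endo (compose (full_shift \<Gamma>) f h)"
    unfolding endo_def
  proof (intro conjI ballI allI)
    have h_in: "h v \<in> full_shift \<Gamma>" if "v \<in> full_shift \<Gamma>" for v
      using f(2) that unfolding endo_def by (blast dest: funcset_mem)
    show "compose (full_shift \<Gamma>) f h \<in> full_shift \<Gamma> \<rightarrow> full_shift \<Gamma>"
    proof (rule funcsetI)
      fix v :: "int \<Rightarrow> 'b" assume v: "v \<in> full_shift \<Gamma>"
      have "f (h v) \<in> full_shift \<Gamma>"
        using f(1) h_in[OF v] unfolding endo_def by (blast dest: funcset_mem)
      then show "compose (full_shift \<Gamma>) f h v \<in> full_shift \<Gamma>"
        using v by (simp add: compose_def)
    qed
    fix v :: "int \<Rightarrow> 'b" and k assume v: "v \<in> full_shift \<Gamma>"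
    then have "h (translate k v) = translate k (h v)" "f (translate k (h v)) = translate k (f (h v))"
      using f h_in[OF v] unfolding endo_def by blast+
    then show "compose (full_shift \<Gamma>) f h (translate k v) = translate k (compose (full_shift \<Gamma>) f h v)"
      using v translate_in_full_shift[OF v] by (simp add: compose_def)
  qed
  have o: "overwritten x (updated h x) (belt_map h x)"
    by (rule overwritten_belt_map[OF f(2) x])
  have hx: "belt_map h x \<in> X" using belt_map_in f x by blast
  \<comment> \<open>The second update supersedes the first, and the belts it reads are already
    images under \<open>h\<close>.\<close>
  have "overwritten x (updated f (belt_map h x)) (belt_map f (belt_map h x))"
    by (rule overwritten_trans[OF x o overwritten_belt_map[OF f(1) hx]])
  then show "overwritten x (updated (compose (full_shift \<Gamma>) f h) x) (belt_map f (belt_map h x))"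
  proof (rule overwritten_cong)
    fix g i assume c: "cell x g i"
    have "belt (belt_map h x) g (i, t) = h (belt x g (i, t))" "belt x g (i, t) \<in> full_shift \<Gamma>" for t
      using belt_overwritten[OF f(2) x o, of g "(i, t)"] belt_in[of x g "(i, t)"] c by simp_all
    then show "updated f (belt_map h x) g i = updated (compose (full_shift \<Gamma>) f h) x g i"
      unfolding updated_def compose_def by simp
  qed
qed (rule x)

lemma belt_map_id:
  assumes x: "x \<in> X" shows "belt_map (\<lambda>y\<in>full_shift \<Gamma>. y) x = x"
proof (rule belt_map_eqI)
  show "endo (\<lambda>y\<in>full_shift \<Gamma>. y)"
    by (simp add: endo_def translate_in_full_shift)
  show "overwritten x (updated (\<lambda>y\<in>full_shift \<Gamma>. y) x) x"
  proof (rule overwritten_cong[OF overwritten_self[OF x]])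
    fix g i assume c: "cell x g i"
    then have "updated (\<lambda>y\<in>full_shift \<Gamma>. y) x g i = (belt x g (i, True) 0, belt x g (i, False) 0)"
      using belt_in by (simp add: updated_def)
    then show "datum x g i = updated (\<lambda>y\<in>full_shift \<Gamma>. y) x g i"
      by (simp add: belt_def)
  qed
qed (rule x)

lemma belt_map_translate:
  assumes f: "endo f" and x: "x \<in> X"
  shows "belt_map f (translate k x) = translate k (belt_map f x)"
proof (rule belt_map_eqI[OF f translate_in[OF x]])
  have o: "overwritten (translate k x) (\<lambda>g i. updated f x g (i + k)) (translate k (belt_map f x))"
    by (rule overwritten_translate[OF x overwritten_belt_map[OF f x]])
  show "overwritten (translate k x) (updated f (translate k x)) (translate k (belt_map f x))"
  proof (rule overwritten_cong[OF o])
    fix g i assume c: "cell (translate k x) g i"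
    have C: "{j. cell (translate k x) g j} = {j. j + k \<in> {j. cell x g j}}"
      using cell_translate[OF x] by simp
    have "belt (translate k x) g (i, t) l = belt x g (i + k, t) l" for t l
    proof -
      obtain p b where pb: "belt_walk n {j. cell x g j} (i + k, t) l = (p, b)" by fastforce
      have "belt_walk n {j. cell (translate k x) g j} (i, t) l = (p - k, b)"
        unfolding C by (subst belt_walk_translate) (simp only: pb apfst_conv)
      moreover have "datum (translate k x) g (p - k) = datum x g p"
        using datum_translate[OF x cellD(1)[OF c], of k "p - k"] by simp
      ultimately show ?thesis
        unfolding belt_def pb by (simp only: prod.case)
    qed
    then have "belt (translate k x) g (i, t) = belt x g (i + k, t)" for t
      by blast
    then show "updated f x g (i + k) = updated f (translate k x) g i"
      by (simp add: updated_def)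
  qed
qed

text \<open>Type \<open>g\<close> in \<open>h x\<close> and type \<open>compose X g h\<close> in
  \<open>x\<close> have the same positions and data, hence the same belts.\<close>

lemma belt_map_action:
  assumes f: "endo f" and x: "x \<in> X" and h: "h \<in> G"
  shows "belt_map f (h x) = h (belt_map f x)"
proof (rule belt_map_eqI[OF f G_in[OF h x]])
  have o: "overwritten (h x) (\<lambda>g i. updated f x (compose X g h) i) (h (belt_map f x))"
    by (rule overwritten_action[OF x h overwritten_belt_map[OF f x]])
  show "overwritten (h x) (updated f (h x)) (h (belt_map f x))"
  proof (rule overwritten_cong[OF o])
    fix g i assume c: "cell (h x) g i"
    have C: "{j. cell (h x) g j} = {j. cell x (compose X g h) j}"
      using cell_action[OF x h cellD(1)[OF c]] by simp
    have "belt (h x) g s l = belt x (compose X g h) s l" for s l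
      unfolding belt_def C by (simp add: datum_action[OF x])
    then have "belt (h x) g s = belt x (compose X g h) s" for s
      by blast
    then show "updated f x (compose X g h) i = updated f (h x) g i"
      by (simp add: updated_def)
  qed
qed

section \<open>Locality and injectivity of the belt maps\<close>

lemma cell_local:
  assumes xy: "x \<in> X" "y \<in> X" "\<And>j. j \<in> {p - r..p + n + r} \<Longrightarrow> x j = y j"
  shows "cell x g p \<longleftrightarrow> cell y g p" and "g \<in> G \<Longrightarrow> datum x g p = datum y g p"
proof -
  have "g x (p + j) = g y (p + j)" if "g \<in> G" "j \<in> {0..<n}" for j
  proof (rule G_local_at[OF that(1) xy(1,2)])
    show "x (p + j + q) = y (p + j + q)" if "\<bar>q\<bar> \<le> r" for q
      using that \<open>j \<in> {0..<n}\<close> by (intro xy(3)) auto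
  qed
  then have "occ (g x) p a \<longleftrightarrow> occ (g y) p a" if "g \<in> G" for a
    using that by (auto simp: occ_def)
  then show "cell x g p \<longleftrightarrow> cell y g p" "g \<in> G \<Longrightarrow> datum x g p = datum y g p"
    by (auto simp: cell_def datum_def)
qed

text \<open>A cell whose zone contains 0 starts within \<open>n\<close> of 0; \<open>\<rho>\<close>
  steps along its belt inspect positions up to \<open>(\<rho> + 1) * n\<close> away from it, and
  recognising a cell there takes another \<open>n + r\<close>. This adds up to the radius.\<close>

lemma belt_map_local:
  assumes f: "endo f" and \<rho>: "0 \<le> \<rho>"
    and loc: "\<And>u v. \<lbrakk>u \<in> full_shift \<Gamma>; v \<in> full_shift \<Gamma>; \<And>j. \<bar>j\<bar> \<le> \<rho> \<Longrightarrow> u j = v j\<rbrakk> \<Longrightarrow> f u 0 = f v 0"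
    and xy: "x \<in> X" "y \<in> X" and eq: "\<And>j. \<bar>j\<bar> \<le> (\<rho> + 3) * n + r \<Longrightarrow> x j = y j"
  shows "belt_map f x 0 = belt_map f y 0"
proof -
  have n: "0 \<le> n" using bounds by simp
  have cells: "cell x g p \<longleftrightarrow> cell y g p" "g \<in> G \<Longrightarrow> datum x g p = datum y g p"
    if p: "\<bar>p\<bar> \<le> (\<rho> + 2) * n" for g p
  proof -
    have "x j = y j" if "j \<in> {p - r..p + n + r}" for j
      using p that n by (intro eq) (auto simp: distrib_right)
    from cell_local[OF xy this] show "cell x g p \<longleftrightarrow> cell y g p" "g \<in> G \<Longrightarrow> datum x g p = datum y g p"
      by blast+
  qed
  have small: "\<bar>p\<bar> \<le> (\<rho> + 2) * n" if "\<bar>p\<bar> \<le> n" for p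
    using that mult_right_mono[of 1 "\<rho> + 2" n] n \<rho> by simp
  have ox: "overwritten x (updated f x) (belt_map f x)" and oy: "overwritten y (updated f y) (belt_map f y)"
    using overwritten_belt_map f xy by blast+
  show ?thesis
  proof (cases "0 \<in> zone x")
    case True
    then obtain g i where c: "cell x g i" and i: "0 \<in> {i + lo - 2 * r..<i + hi + 2 * r}"
      by (auto simp: zone_def)
    have g: "g \<in> G" using c cellD by blast
    have i_le: "\<bar>i\<bar> \<le> n" using i bounds by auto
    have cy: "cell y g i" using c cells(1) small i_le by blast
    have "belt x g (i, t) k = belt y g (i, t) k" if k: "\<bar>k\<bar> \<le> \<rho>" for t k
    proof -
      have *: "(\<bar>k\<bar> + 1) * n \<le> (\<rho> + 1) * n"
        using k n by (intro mult_right_mono) auto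
      have C: "p \<in> {i. cell x g i} \<longleftrightarrow> p \<in> {i. cell y g i}" if "\<bar>p - i\<bar> \<le> (\<bar>k\<bar> + 1) * n" for p
      proof -
        have "\<bar>p\<bar> \<le> (\<rho> + 2) * n" using that * i_le by (simp add: distrib_right)
        then show ?thesis using cells(1) by blast
      qed
      obtain p b where pb: "belt_walk n {i. cell x g i} (i, t) k = (p, b)" by fastforce
      have pb': "belt_walk n {i. cell y g i} (i, t) k = (p, b)"
        using belt_walk_local(1)[where i = i and k = k and t = t, OF n C] pb by simp
      have "\<bar>p - i\<bar> \<le> \<bar>k\<bar> * n"
        using belt_walk_local(2)[where i = i and k = k and t = t, OF n C] pb by simp
      then have "\<bar>p\<bar> \<le> (\<rho> + 2) * n"
        using * i_le n by (simp add: distrib_right)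
      then show ?thesis
        unfolding belt_def pb pb' using cells(2) g by simp
    qed
    then have "updated f x g i = updated f y g i"
      unfolding updated_def using belt_in[of x g "(i, _)"] belt_in[of y g "(i, _)"] c cy
      by (simp add: loc)
    then show ?thesis
      using ox oy c cy by (intro determined_in_cell[OF g _ _ _ _ i]) (auto simp: overwritten_def)
  next
    case False
    have "0 \<notin> zone y"
    proof
      assume "0 \<in> zone y"
      then obtain g i where c: "cell y g i" and i: "0 \<in> {i + lo - 2 * r..<i + hi + 2 * r}"
        by (auto simp: zone_def)
      have "\<bar>i\<bar> \<le> n" using i bounds by auto
      then have "cell x g i" using c cells(1) small by blast
      then show False using False i unfolding zone_def by blast
    qed
    have "v 0 = (\<lambda>x\<in>X. x) v 0" if "v \<in> X" for v using that by simp
    then have "belt_map f x 0 = x 0" "belt_map f y 0 = y 0"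
      using ox oy False \<open>0 \<notin> zone y\<close> G_one xy unfolding overwritten_def by metis+
    then show ?thesis using eq[of 0] \<rho> n r_nonneg by simp
  qed
qed

lemma belt_map_inj:
  assumes f: "endo f" "endo h" and eq: "\<And>x. x \<in> X \<Longrightarrow> belt_map f x = belt_map h x"
    and u: "u \<in> full_shift \<Gamma>"
  shows "f u = h u"
proof
  fix k
  \<comment> \<open>Adjacent cells of identity type spell out \<open>u\<close> on the upper track;
    the second component is a filler.\<close>
  obtain x where x: "x \<in> X" and occ: "\<And>k. \<forall>j\<in>{0..<n}. x (k * n + j) = W (u k, u k) j"
    using concat[of "\<lambda>k. (u k, u k)"] u by auto
  let ?e = "\<lambda>x\<in>X. x"
  have ex: "?e x = x" using x by simp
  have dat: "cell x ?e (k * n)" "datum x ?e (k * n) = (u k, u k)" for k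
  proof -
    have "occ (?e x) (k * n) (u k, u k)" unfolding ex occ_def using occ by blast
    moreover have "(u k, u k) \<in> \<Gamma> \<times> \<Gamma>" using u by auto
    ultimately show "cell x ?e (k * n)" "datum x ?e (k * n) = (u k, u k)"
      using G_one unfolding cell_def by (blast, intro datum_eq)
  qed
  \<comment> \<open>A further cell, at \<open>q * n + m\<close>, would keep distance
    \<open>E\<close> from both \<open>q * n\<close> and \<open>(q + 1) * n\<close>, but the two
    bounds on \<open>E\<close> add up to \<open>n < 2 * E\<close>.\<close>
  have C: "{i. cell x ?e i} = range (\<lambda>k. k * n)"
  proof
    have "i \<in> range (\<lambda>k. k * n)" if c: "cell x ?e i" for i
    proof -
      define q m where "q = i div n" and "m = i mod n"
      have m: "0 \<le> m" "m < n" "i = q * n + m"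
        using bounds by (auto simp: q_def m_def)
      have "q * n = i \<or> E \<le> m"
        using cells_apart[OF x c dat(1)[of q]] m by auto
      moreover have "E \<le> n - m"
        using cells_apart[OF x c dat(1)[of "q + 1"]] m by (auto simp: distrib_right)
      ultimately have "i = q * n" using bounds by linarith
      then show ?thesis by (rule range_eqI)
    qed
    then show "{i. cell x ?e i} \<subseteq> range (\<lambda>k. k * n)" by blast
  qed (use dat in auto)
  have belt: "belt x ?e (0, True) = u"
    by (rule ext) (simp add: belt_def C belt_walk_full dat)
  have "f u k = belt (belt_map f x) ?e (0, True) k" "h u k = belt (belt_map h x) ?e (0, True) k"
    using belt_overwritten[OF _ x overwritten_belt_map[OF _ x], of _ ?e "(0, True)"] f belt dat(1)[of 0]
    by simp_all
  then show "f u k = h u k" using eq[OF x] by simp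
qed

end

section \<open>Marker words\<close>

lemma int_div_less_iff: "0 < P \<Longrightarrow> j div P < c \<longleftrightarrow> j < c * P" for j P c :: int
proof -
  assume P: "0 < P"
  have j: "j = j div P * P + j mod P" "0 \<le> j mod P" "j mod P < P" using P by simp_all
  have "j < c * P" if "j div P < c"
  proof -
    have "(j div P + 1) * P \<le> c * P"
      using that P by (intro mult_right_mono) auto
    then show ?thesis
      using j unfolding distrib_right by linarith
  qed
  moreover have "c * P \<le> j" if "c \<le> j div P"
  proof -
    have "c * P \<le> j div P * P"
      using that P by (intro mult_right_mono) auto
    then show ?thesis
      using j by linarith
  qed
  ultimately show ?thesis by linarith
qed

lemma int_le_div_iff: "0 < P \<Longrightarrow> c \<le> j div P \<longleftrightarrow> c * P \<le> j" for j P c :: int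
  using int_div_less_iff[of P j c] by linarith

text \<open>\<open>u S\<close> is the concatenation of two blocks of length \<open>P\<close>, with the marked block exactly at the
  indices in \<open>S\<close>.\<close>

locale block_system = shift_action X G r T
  for X :: "(int \<Rightarrow> 'a) set" and G r T +
  fixes P :: int and u :: "int set \<Rightarrow> int \<Rightarrow> 'a"
  assumes T_le_P: "T \<le> P"
    and u_in: "u S \<in> X"
    and u_block: "\<lbrakk>j div P \<in> S \<longleftrightarrow> j' div P \<in> S'; j mod P = j' mod P\<rbrakk> \<Longrightarrow> u S j = u S' j'"
    and u_neq: "u {0} \<noteq> u {}"
    and u_moved: "\<lbrakk>g \<in> G; g \<noteq> (\<lambda>x\<in>X. x)\<rbrakk> \<Longrightarrow> g (u {0}) \<noteq> u {0}"
begin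

lemma P_pos: "0 < P" and r_less_P: "r < P"
  using T_le_P r_le r_nonneg by linarith+

lemma mark_obtain:
  obtains j0 where "0 \<le> j0" "j0 < P" "u {0} j0 \<noteq> u {} j0"
proof -
  obtain j where j: "u {0} j \<noteq> u {} j" using u_neq by blast
  then have "j div P = 0" using u_block[of j "{0}" j "{}"] by auto
  then have "0 \<le> j" "j < P"
    using int_div_less_iff[OF P_pos, of j 1] int_le_div_iff[OF P_pos, of 0 j] by simp_all
  then show thesis using that j by blast
qed

lemma u_aperiodic:
  assumes g: "g \<in> G" and per: "\<And>j. g (u {0}) (j + k) = u {0} j"
  shows "k = 0 \<and> g = (\<lambda>x\<in>X. x)"
proof (cases "k = 0")
  case True
  then have "g (u {0}) = u {0}" using per by auto
  then show ?thesis using True u_moved[OF g] by blast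
next
  case False
  let ?u = "u {0}"
  have gu: "translate k (g ?u) = ?u" using per by (intro ext) (simp add: translate_apply)
  \<comment> \<open>As \<open>G\<close> is finite, two of these \<open>h\<close> coincide. Then \<open>u {0}\<close> is periodic, which its
    only mark prevents.\<close>
  have "\<exists>h\<in>G. translate (k * int t) (h ?u) = ?u" for t
  proof (induction t)
    case 0
    show ?case using G_one u_in by (intro bexI[of _ "\<lambda>x\<in>X. x"]) simp_all
  next
    case (Suc t)
    then obtain h where h: "h \<in> G" "translate (k * int t) (h ?u) = ?u" by blast
    have "?u = translate k (g (translate (k * int t) (h ?u)))"
      unfolding h gu ..
    also have "\<dots> = translate (k * int (Suc t)) (compose X g h ?u)"
      unfolding G_translate[OF g G_in[OF h(1) u_in]] using u_in by (simp add: compose_def algebra_simps)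
    finally show ?case using G_compose[OF g h(1)] by metis
  qed
  then obtain H where H: "H t \<in> G" "translate (k * int t) (H t ?u) = ?u" for t by metis
  have "\<not> inj H"
  proof
    assume "inj H"
    then have "finite (UNIV :: nat set)"
      using finite_G H(1) by (metis finite_imageD finite_subset image_subsetI)
    then show False by simp
  qed
  then obtain s t where st: "s \<noteq> t" "H s = H t" by (auto simp: inj_def)
  define d where "d = k * (int t - int s)"
  have d: "d \<noteq> 0" using st False by (simp add: d_def)
  have "translate (- (k * int t)) ?u = H t ?u" for t
    using arg_cong[OF H(2)[of t], of "translate (- (k * int t))"] by simp
  then have "translate (- (k * int t)) ?u = translate (- (k * int s)) ?u"
    using st by metis
  from arg_cong[OF this, of "translate (k * int t)"]
  have step: "translate d ?u = ?u" by (simp add: d_def right_diff_distrib)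
  have iter: "translate (int m * d) ?u = ?u" for m
  proof (induction m)
    case (Suc m)
    have "translate (int (Suc m) * d) ?u = translate d (translate (int m * d) ?u)"
      by (simp add: distrib_right add.commute)
    then show ?case unfolding Suc step .
  qed simp
  obtain j0 where j0: "0 \<le> j0" "j0 < P" "?u j0 \<noteq> u {} j0" by (rule mark_obtain)
  \<comment> \<open>Repeating the period \<open>P * \<bar>d\<bar>\<close> times displaces by a
    nonzero number of whole blocks, so the marked block is compared with an unmarked one.\<close>
  have "?u (j0 + int (nat (P * \<bar>d\<bar>)) * d) = ?u j0"
    using fun_cong[OF iter, of "nat (P * \<bar>d\<bar>)" j0] by (simp add: translate_apply)
  then have *: "?u (j0 + (\<bar>d\<bar> * d) * P) = ?u j0"
    using P_pos by (simp add: mult_ac)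
  have "?u (j0 + (\<bar>d\<bar> * d) * P) = u {} j0"
    using P_pos j0 d by (intro u_block) simp_all
  then show ?thesis using * j0 by simp
qed

text \<open>Only finitely many pairs of a group element and a displacement occur, so the witnesses
  given by \<open>u_aperiodic\<close> fit into one window.\<close>

lemma displacement_bound:
  obtains R where "0 \<le> R" "\<And>g k. \<lbrakk>g \<in> G; \<bar>k\<bar> \<le> c; \<not> (k = 0 \<and> g = (\<lambda>x\<in>X. x))\<rbrakk> \<Longrightarrow>
    \<exists>j. \<bar>j\<bar> \<le> R \<and> g (u {0}) (j + k) \<noteq> u {0} j"
proof -
  define B where "B = (G \<times> {-c..c}) - {(\<lambda>x\<in>X. x, 0)}"
  have "\<exists>j. fst p (u {0}) (j + snd p) \<noteq> u {0} j" if "p \<in> B" for p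
    using u_aperiodic[of "fst p" "snd p"] that by (cases p) (auto simp: B_def)
  then obtain J where J: "\<And>p. p \<in> B \<Longrightarrow> fst p (u {0}) (J p + snd p) \<noteq> u {0} (J p)" by metis
  have fin: "finite B" using finite_G by (simp add: B_def)
  show thesis
  proof (rule that[of "Max (insert 0 ((\<lambda>p. \<bar>J p\<bar>) ` B))"])
    show "0 \<le> Max (insert 0 ((\<lambda>p. \<bar>J p\<bar>) ` B))" using fin by simp
    fix g k assume "g \<in> G" "\<bar>k\<bar> \<le> c" "\<not> (k = 0 \<and> g = (\<lambda>x\<in>X. x))"
    then have gk: "(g, k) \<in> B" by (auto simp: B_def)
    then have "\<bar>J (g, k)\<bar> \<le> Max (insert 0 ((\<lambda>p. \<bar>J p\<bar>) ` B))"
      using fin by (intro Max_ge) auto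
    then show "\<exists>j. \<bar>j\<bar> \<le> Max (insert 0 ((\<lambda>p. \<bar>J p\<bar>) ` B)) \<and> g (u {0}) (j + k) \<noteq> u {0} j"
      using J[OF gk] by auto
  qed
qed

end

text \<open>\<open>M\<close> leaves enough unmarked blocks after the first mark to recognise
  \<open>u {0}\<close> there, even displaced by \<open>2 * P\<close>. \<open>K\<close> is so large
  that at displacements above \<open>K * P - 2 * P\<close> the first mark of the later word falls
  into the tail of the earlier one.\<close>

locale marker_words = block_system +
  fixes R M N K :: int
  assumes R: "\<lbrakk>g \<in> G; \<bar>k\<bar> \<le> 2 * P; \<not> (k = 0 \<and> g = (\<lambda>x\<in>X. x))\<rbrakk> \<Longrightarrow>
      \<exists>j. \<bar>j\<bar> \<le> R \<and> g (u {0}) (j + k) \<noteq> u {0} j"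
    and N: "0 \<le> N" and M: "3 \<le> M" "R + 2 * P + r \<le> M" and K: "K = M + N + 6"
begin

text \<open>The first mark has a fixed place and synchronises; the place of the second one encodes
  the datum.\<close>

definition word :: "int \<Rightarrow> int \<Rightarrow> 'a"
  where "word a = u {K, K + 1 + M + a}"

abbreviation "len \<equiv> 2 * K + 2 * M + N + 3"

lemma word_head: "j < (K - 1) * P \<Longrightarrow> a \<in> {0..N} \<Longrightarrow> word a j = word a (j + P)"
proof -
  assume j: "j < (K - 1) * P" and a: "a \<in> {0..N}"
  then have "j div P < K - 1" using P_pos by (simp add: int_div_less_iff)
  then show ?thesis
    unfolding word_def using P_pos a M by (intro u_block) auto
qed

lemma word_mark: "\<lbrakk>j < (M + 1) * P; a \<in> {0..N}\<rbrakk> \<Longrightarrow> word a (K * P + j) = u {0} j"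
proof -
  assume j: "j < (M + 1) * P" and a: "a \<in> {0..N}"
  then have "j div P < M + 1" using int_div_less_iff[OF P_pos] by blast
  moreover have "(K * P + j) div P = K + j div P" "(K * P + j) mod P = j mod P"
    using P_pos by simp_all
  ultimately show ?thesis
    unfolding word_def using a by (intro u_block) auto
qed

lemma word_tail: "(K + M + N + 2) * P \<le> j \<Longrightarrow> a \<in> {0..N} \<Longrightarrow> word a j = word a (j + P)"
proof -
  assume j: "(K + M + N + 2) * P \<le> j" and a: "a \<in> {0..N}"
  then have "K + M + N + 2 \<le> j div P" using P_pos by (simp add: int_le_div_iff)
  then show ?thesis
    unfolding word_def using P_pos a M N by (intro u_block) auto
qed

text \<open>The block before the first mark is unmarked, so \<open>P\<close>-periodicity fails
  there, at the same position for all \<open>a\<close>.\<close>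

lemma word_break:
  obtains j0 where "0 \<le> j0" "j0 < P" "\<And>a. a \<in> {0..N} \<Longrightarrow> word a (K * P + j0) \<noteq> word a (K * P + (j0 - P))"
proof -
  obtain j0 where j0: "0 \<le> j0" "j0 < P" "u {0} j0 \<noteq> u {} j0" by (rule mark_obtain)
  have "u {0} (j0 - P) = u {} j0"
    using j0 P_pos by (intro u_block) (auto simp: zdiv_eq_0_iff)
  moreover have "1 * P \<le> (M + 1) * P"
    using P_pos M by (intro mult_right_mono) auto
  then have "j0 < (M + 1) * P" "j0 - P < (M + 1) * P"
    using j0 P_pos by linarith+
  ultimately have "word a (K * P + j0) \<noteq> word a (K * P + (j0 - P))" if "a \<in> {0..N}" for a
    using j0 word_mark[OF _ that, of j0] word_mark[OF _ that, of "j0 - P"] by simp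
  then show thesis using that j0 by blast
qed

section \<open>Separation of the marker words\<close>

lemma separation_ahead:
  assumes x: "x \<in> X" and g: "g \<in> G" and ab: "a \<in> {0..N}" "b \<in> {0..N}"
    and xa: "\<And>j. j \<in> {0..<len * P} \<Longrightarrow> x (i + j) = word a j"
    and gb: "\<And>j. j \<in> {0..<len * P} \<Longrightarrow> g x (i + k + j) = word b j"
    and k: "0 \<le> k" "k < (K + M + N + 4) * P"
  shows "k = 0 \<and> g = (\<lambda>x\<in>X. x)"
proof (rule ccontr)
  assume neq: "\<not> ?thesis"
  obtain j0 where j0: "0 \<le> j0" "j0 < P"
      "\<And>a. a \<in> {0..N} \<Longrightarrow> word a (K * P + j0) \<noteq> word a (K * P + (j0 - P))"
    by (rule word_break) blast
  have KP: "K * P = M * P + N * P + 6 * P" by (simp add: K distrib_right)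
  have MP: "3 * P \<le> M * P" "0 \<le> N * P" "M \<le> M * P"
    using M N P_pos mult_right_mono[of 3 M P] mult_left_mono[of 1 P M] by auto
  have lenP: "len * P = 2 * (K * P) + 2 * (M * P) + N * P + 3 * P" by (simp add: algebra_simps)
  have MR: "R + 2 * P + r \<le> M * P" using MP M by linarith
  have gb': "g x (i + k + j) = word b j" if "0 \<le> j" "j < 2 * (K * P) + 2 * (M * P) + N * P + 3 * P" for j
    using that lenP by (intro gb) simp
  have xa': "x (i + j) = word a j" if "0 \<le> j" "j < 2 * (K * P) + 2 * (M * P) + N * P + 3 * P" for j
    using that lenP by (intro xa) simp
  have mark: "word c (K * P + j) = u {0} j" if "c \<in> {a, b}" "j < M * P + P" for c j
    using that ab by (intro word_mark) (auto simp: distrib_right)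
  have head: "word b j = word b (j + P)" if "j < K * P - P" for j
    using that ab by (intro word_head) (auto simp: left_diff_distrib)
  have tail: "word a j = word a (j + P)" if "K * P + M * P + N * P + 2 * P \<le> j" for j
    using that ab by (intro word_tail) (auto simp: distrib_right)
  have kE: "k < K * P + M * P + N * P + 4 * P" using k by (simp add: distrib_right)
  note arith = KP MP(1,2) MR P_pos r_less_P r_nonneg k(1) kE j0(1,2)
  consider "k \<le> 2 * P" | "2 * P < k" "k \<le> K * P - 2 * P" | "K * P - 2 * P < k" by linarith
  then show False
  proof cases
    case 1 \<comment> \<open>around its first mark, each word looks like \<open>u {0}\<close>\<close>
    have "\<bar>k\<bar> \<le> 2 * P" using 1 k by simp
    then obtain j where j: "\<bar>j\<bar> \<le> R" "g (u {0}) (j + k) \<noteq> u {0} j"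
      using R[OF g] neq by blast
    have "g x (i + k + (K * P + j)) = word b (K * P + j)"
      using j(1) 1 arith by (intro gb') linarith+
    also have "\<dots> = u {0} j"
      using j(1) 1 arith by (intro mark) (blast, linarith)
    finally have "g x (i + k + (K * P + j)) = u {0} j" .
    moreover have "g x (i + k + (K * P + j)) = g (u {0}) (j + k)"
    proof (rule G_local_at[OF g x u_in])
      fix q assume q: "\<bar>q\<bar> \<le> r"
      have "x (i + (K * P + (j + k + q))) = word a (K * P + (j + k + q))"
        using j(1) 1 q arith by (intro xa') linarith+
      also have "\<dots> = u {0} (j + k + q)"
        using j(1) 1 q arith by (intro mark) (blast, linarith)
      finally show "x (i + k + (K * P + j) + q) = u {0} (j + k + q)"
        by (simp only: add_ac)
    qed
    ultimately show False using j(2) by simp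
  next
    case 2 \<comment> \<open>the first mark of the word in \<open>x\<close> lies in the periodic head of the word in \<open>g x\<close>\<close>
    obtain h where h: "h \<in> G" "\<And>x. x \<in> X \<Longrightarrow> h (g x) = x"
      using G_inverse_obtain[OF g] by metis
    \<comment> \<open>The place where the word in \<open>x\<close> breaks periodicity, counted from
      the start of the word in \<open>g x\<close>.\<close>
    define l where "l = K * P + (j0 - P) - k"
    have "h (g x) (i + k + l) = h (g x) (i + k + (l + P))"
    proof (rule G_local_at[OF h(1) G_in[OF g x] G_in[OF g x]])
      fix q assume q: "\<bar>q\<bar> \<le> r"
      have "g x (i + k + (l + q)) = word b (l + q)"
        using 2 q arith l_def by (intro gb') linarith+
      also have "\<dots> = word b (l + q + P)"
        using 2 q arith l_def by (intro head) linarith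
      also have "\<dots> = g x (i + k + (l + q + P))"
        using 2 q arith l_def by (intro gb'[symmetric]) linarith+
      finally show "g x (i + k + l + q) = g x (i + k + (l + P) + q)"
        by (simp only: add_ac)
    qed
    then have "x (i + (K * P + (j0 - P))) = x (i + (K * P + j0))"
      unfolding h(2)[OF x] by (simp add: l_def algebra_simps)
    moreover have "x (i + (K * P + (j0 - P))) = word a (K * P + (j0 - P))"
      using arith by (intro xa') linarith+
    moreover have "x (i + (K * P + j0)) = word a (K * P + j0)"
      using arith by (intro xa') linarith+
    ultimately show False using j0(3)[OF ab(1)] by simp
  next
    case 3 \<comment> \<open>the first mark of the word in \<open>g x\<close> lies in the periodic tail of the word in \<open>x\<close>\<close>
    define l where "l = k + (K * P + (j0 - P))"
    have "g x (i + l) = g x (i + (l + P))"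
    proof (rule G_local_at[OF g x x])
      fix q assume q: "\<bar>q\<bar> \<le> r"
      have "x (i + (l + q)) = word a (l + q)"
        using 3 q arith l_def by (intro xa') linarith+
      also have "\<dots> = word a (l + q + P)"
        using 3 q arith l_def by (intro tail) linarith
      also have "\<dots> = x (i + (l + q + P))"
        using 3 q arith l_def by (intro xa'[symmetric]) linarith+
      finally show "x (i + l + q) = x (i + (l + P) + q)"
        by (simp only: add_ac)
    qed
    then have "g x (i + k + (K * P + (j0 - P))) = g x (i + k + (K * P + j0))"
      by (simp add: l_def algebra_simps)
    moreover have "g x (i + k + (K * P + (j0 - P))) = word b (K * P + (j0 - P))"
      using arith by (intro gb') linarith+
    moreover have "g x (i + k + (K * P + j0)) = word b (K * P + j0)"
      using arith by (intro gb') linarith+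
    ultimately show False using j0(3)[OF ab(2)] by simp
  qed
qed

text \<open>The words differ only in the blocks that can hold the second mark. \<open>len\<close>
  puts these in the middle, so that \<open>hi\<close> equals \<open>n - lo\<close>, and
  \<open>E\<close> exceeds both by \<open>2 * P\<close>.\<close>

lemma cell_words:
  assumes enc: "inj_on enc A" "enc ` A \<subseteq> {0..N}"
  shows "cell_words X G r T A (\<lambda>a. word (enc a)) (len * P) ((K + M + 1) * P) ((K + M + N + 2) * P)
    ((K + M + N + 4) * P)"
proof unfold_locales
  have e: "enc a \<in> {0..N}" if "a \<in> A" for a using enc that by auto
  show "\<exists>x\<in>X. \<forall>k. \<forall>j\<in>{0..<len * P}. x (k * (len * P) + j) = word (enc (s k)) j"
    if s: "\<And>k. s k \<in> A" for s
  proof -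
    \<comment> \<open>A sequence of words is itself a single \<open>u S\<close>, where
      \<open>S\<close> collects the two marks of every word.\<close>
    define S where "S = (\<Union>k. {k * len + K, k * len + (K + 1 + M + enc (s k))})"
    have "u S (k * (len * P) + j) = word (enc (s k)) j" if j: "j \<in> {0..<len * P}" for k j
      unfolding word_def
    proof (rule u_block)
      have b: "0 \<le> j div P" "j div P < len"
        using j P_pos by (auto simp: pos_imp_zdiv_nonneg_iff int_div_less_iff)
      have "k * (len * P) + j = j + (k * len) * P" by (simp add: algebra_simps)
      then have dm: "(k * (len * P) + j) div P = k * len + j div P" "(k * (len * P) + j) mod P = j mod P"
        using P_pos by (simp_all only: div_mult_self2 mod_mult_self1) simp_all
      show "(k * (len * P) + j) mod P = j mod P" by (rule dm)
      have uniq: "k * len + c = k' * len + c' \<longleftrightarrow> k = k' \<and> c = c'"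
        if "0 \<le> c" "c < len" "0 \<le> c'" "c' < len" for k k' c c'
      proof
        assume *: "k * len + c = k' * len + c'"
        then have "(k * len + c) div len = (k' * len + c') div len" by simp
        then have "k = k'" using that by simp
        then show "k = k' \<and> c = c'" using * by simp
      qed simp
      have 1: "k * len + j div P = k' * len + K \<longleftrightarrow> k = k' \<and> j div P = K" for k'
        using b K M N by (intro uniq) auto
      have 2: "k * len + j div P = k' * len + (K + 1 + M + enc (s k')) \<longleftrightarrow>
          k = k' \<and> j div P = K + 1 + M + enc (s k')" for k'
        using b e[OF s, of k'] K M N by (intro uniq) auto
      have "k * len + j div P \<in> S \<longleftrightarrow> (\<exists>k'. k * len + j div P = k' * len + K \<or>
          k * len + j div P = k' * len + (K + 1 + M + enc (s k')))"
        by (simp only: S_def UN_iff bex_UNIV insert_iff empty_iff simp_thms)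
      also have "\<dots> \<longleftrightarrow> j div P \<in> {K, K + 1 + M + enc (s k)}"
        unfolding 1 2 by blast
      finally have "k * len + j div P \<in> S \<longleftrightarrow> j div P \<in> {K, K + 1 + M + enc (s k)}" .
      then show "(k * (len * P) + j) div P \<in> S \<longleftrightarrow> j div P \<in> {K, K + 1 + M + enc (s k)}"
        unfolding dm .
    qed
    then show ?thesis using u_in by blast
  qed
  show "word (enc a) j = word (enc b) j"
    if "a \<in> A" "b \<in> A" "j \<in> {0..<len * P}" "j \<notin> {(K + M + 1) * P..<(K + M + N + 2) * P}" for a b j
  proof -
    have "j div P < K + M + 1 \<or> K + M + N + 2 \<le> j div P"
      using that(4) int_div_less_iff[OF P_pos, of j "K + M + 1"] int_le_div_iff[OF P_pos, of "K + M + N + 2" j]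
      unfolding atLeastLessThan_iff by linarith
    then show ?thesis
      unfolding word_def using e[OF that(1)] e[OF that(2)] by (intro u_block) auto
  qed
  show "a = b" if ab: "a \<in> A" "b \<in> A" and eq: "\<And>j. j \<in> {0..<len * P} \<Longrightarrow> word (enc a) j = word (enc b) j" for a b
  proof (rule ccontr)
    assume "a \<noteq> b"
    then have neq: "enc a \<noteq> enc b" using enc ab by (auto dest: inj_onD)
    obtain j0 where j0: "0 \<le> j0" "j0 < P" "u {0} j0 \<noteq> u {} j0" by (rule mark_obtain)
    \<comment> \<open>A position in the block of the second mark of \<open>a\<close>, which is
      unmarked in the word of \<open>b\<close>.\<close>
    let ?j = "j0 + (K + 1 + M + enc a) * P"
    have dm: "?j div P = K + 1 + M + enc a" "?j mod P = j0"
      using j0 P_pos by simp_all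
    have "word (enc a) ?j = u {0} j0" "word (enc b) ?j = u {} j0"
      unfolding word_def using dm j0 e[OF ab(1)] e[OF ab(2)] neq M by (auto intro!: u_block)
    moreover have "?j \<in> {0..<len * P}"
    proof -
      have "0 \<le> (K + 1 + M + enc a) * P" "(K + 1 + M + enc a + 1) * P \<le> len * P"
        using e[OF ab(1)] K M N P_pos by (auto intro!: mult_right_mono mult_nonneg_nonneg)
      then show ?thesis using j0 by (simp add: distrib_right)
    qed
    ultimately show False using eq j0 by metis
  qed
  show "k = i \<and> g = (\<lambda>x\<in>X. x) \<or> (K + M + N + 4) * P \<le> \<bar>k - i\<bar>"
    if x: "x \<in> X" and g: "g \<in> G" and ab: "a \<in> A" "b \<in> A"
      and xa: "\<And>j. j \<in> {0..<len * P} \<Longrightarrow> x (i + j) = word (enc a) j"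
      and gb: "\<And>j. j \<in> {0..<len * P} \<Longrightarrow> g x (k + j) = word (enc b) j" for x g a b i k
  proof (rule ccontr)
    assume neg: "\<not> ?thesis"
    show False
    proof (cases "i \<le> k")
      case True
      have "k - i = 0 \<and> g = (\<lambda>x\<in>X. x)"
        using gb neg True by (intro separation_ahead[OF x g e[OF ab(1)] e[OF ab(2)] xa]) auto
      then show False using neg by simp
    next
      case False
      \<comment> \<open>In the opposite order the two words exchange roles, as the inverse of
        \<open>g\<close> takes \<open>g x\<close> back to \<open>x\<close>.\<close>
      obtain h where h: "h \<in> G" "\<And>x. x \<in> X \<Longrightarrow> h (g x) = x"
        using G_inverse_obtain[OF g] by metis
      have "i - k = 0 \<and> h = (\<lambda>x\<in>X. x)"
        using xa neg False h(2)[OF x]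
        by (intro separation_ahead[OF G_in[OF g x] h(1) e[OF ab(2)] e[OF ab(1)] gb]) auto
      then show False using False by simp
    qed
  qed
  have "2 * P \<le> (K + M + 1) * P" "(K + M + N + 2) * P + 2 * P \<le> len * P"
      "(K + M + N + 2) * P + 2 * P \<le> (K + M + N + 4) * P"
      "len * P - (K + M + 1) * P + 2 * P \<le> (K + M + N + 4) * P"
    using K M N P_pos mult_right_mono[of 2 "K + M + 1" P] mult_right_mono[of "K + M + N + 4" len P]
    by (auto simp: algebra_simps)
  then show "2 * T \<le> (K + M + 1) * P" "(K + M + N + 2) * P + 2 * T \<le> len * P"
      "(K + M + N + 2) * P + 2 * r \<le> (K + M + N + 4) * P"
      "len * P - (K + M + 1) * P + 2 * r \<le> (K + M + N + 4) * P"
    using T_le_P r_less_P by linarith+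
  show "(K + M + 1) * P < (K + M + N + 2) * P"
    using N P_pos by (intro mult_strict_right_mono) auto
qed

end

section \<open>Existence of the blocks\<close>

context shift_action
begin

text \<open>The unmarked block stays near \<open>x0\<close> at all multiples of \<open>n\<close>; the marked block visits in turn
  \<open>y0\<close>, which makes it different, and for every \<open>g \<in> G\<close> a point moved by \<open>g\<close>.\<close>

lemma block_system_exists:
  assumes mix: "\<And>x y L. x \<in> X \<Longrightarrow> y \<in> X \<Longrightarrow>
      \<exists>N. \<forall>n\<ge>N. \<exists>v\<in>X. \<forall>j. \<bar>j\<bar> \<le> L \<longrightarrow> v j = x j \<and> v (j + int n) = y j"
    and nontrivial: "x1 \<in> X" "x2 \<in> X" "x1 \<noteq> x2"
  shows "\<exists>P u. block_system X G r T P u"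
proof -
  obtain i where i: "x1 i \<noteq> x2 i" using nontrivial by blast
  define x0 where "x0 = translate i x1"
  define y0 where "y0 = translate i x2"
  have xy0: "x0 \<in> X" "y0 \<in> X" "x0 0 \<noteq> y0 0"
    using nontrivial translate_in i by (simp_all add: x0_def y0_def translate_apply)
  have "\<exists>v\<in>X. g v 0 \<noteq> v 0" if g: "g \<in> G" "g \<noteq> (\<lambda>x\<in>X. x)" for g
  proof (rule ccontr)
    assume neg: "\<not> ?thesis"
    have "g x = x" if x: "x \<in> X" for x
    proof
      fix j
      have "g (translate j x) 0 = translate j x 0" using neg translate_in[OF x] by blast
      then show "g x j = x j" using G_translate[OF g(1) x] by (simp add: translate_apply)
    qed
    then have "g = (\<lambda>x\<in>X. x)"
      using G_ext[OF g(1)] by (intro extensionalityI[of _ X]) auto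
    then show False using g by simp
  qed
  then obtain mv where mv: "\<And>g. \<lbrakk>g \<in> G; g \<noteq> (\<lambda>x\<in>X. x)\<rbrakk> \<Longrightarrow> mv g \<in> X \<and> g (mv g) 0 \<noteq> mv g 0"
    by metis
  \<comment> \<open>The identity moves no point; \<open>x0\<close> is a placeholder for it in the
    list.\<close>
  define move where "move g = (if g = (\<lambda>x\<in>X. x) then x0 else mv g)" for g
  have move_in: "move g \<in> X" if "g \<in> G" for g using mv xy0 that by (simp add: move_def)
  obtain gs where gs: "set gs = G" using finite_G finite_list by blast
  define ys where "ys = y0 # map move gs"
  define Y where "Y = insert x0 (set ys)"
  have Y: "Y \<subseteq> X" "finite Y" "x0 \<in> Y" "set ys \<subseteq> Y"
    using xy0 move_in gs by (auto simp: Y_def ys_def)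

  obtain N where N: "\<And>x y n. \<lbrakk>x \<in> X; y \<in> X; N x y \<le> n\<rbrakk> \<Longrightarrow>
      \<exists>v\<in>X. \<forall>j. \<bar>j\<bar> \<le> T \<longrightarrow> v j = x j \<and> v (j + int n) = y j"
    using mix[of _ _ T] by metis
  \<comment> \<open>Finitely many pairs from \<open>Y\<close> admit a common gap. It exceeds
    \<open>T\<close>, so that a window of length \<open>T\<close> meets at most one
    junction.\<close>
  define n' where "n' = Max (insert (nat T + 1) ((\<lambda>(x, y). N x y) ` (Y \<times> Y)))"
  define n where "n = int n'"
  have "N x y \<le> n'" if "x \<in> Y" "y \<in> Y" for x y
    unfolding n'_def using that Y by (intro Max_ge) auto
  then have "\<exists>v. v \<in> X \<and> (\<forall>j. \<bar>j\<bar> \<le> T \<longrightarrow> v j = x j \<and> v (j + n) = y j)" if "x \<in> Y" "y \<in> Y" for x y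
    using N[of x y n'] that Y(1) unfolding n_def by blast
  then have "\<forall>x\<in>Y. \<forall>y\<in>Y. \<exists>v. v \<in> X \<and> (\<forall>j. \<bar>j\<bar> \<le> T \<longrightarrow> v j = x j \<and> v (j + n) = y j)"
    by blast
  then obtain V where V': "\<forall>x\<in>Y. \<forall>y\<in>Y. V x y \<in> X \<and> (\<forall>j. \<bar>j\<bar> \<le> T \<longrightarrow> V x y j = x j \<and> V x y (j + n) = y j)"
    unfolding bchoice_iff by blast
  have V_in: "V x y \<in> X" if "x \<in> Y" "y \<in> Y" for x y
    using V' that by blast
  have V: "V x y j = x j \<and> V x y (j + n) = y j" if "x \<in> Y" "y \<in> Y" "\<bar>j\<bar> \<le> T" for x y j
    using V' that by blast
  have "nat T + 1 \<le> n'" unfolding n'_def using Y by (intro Max_ge) auto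
  then have n: "T < n" "0 < n" unfolding n_def by linarith+
  have T: "0 < T" "r < T" using r_le r_nonneg by auto

  define c where "c s j = V (s (j div n)) (s (j div n + 1)) (j mod n)" for s :: "int \<Rightarrow> int \<Rightarrow> 'a" and j
  have c_at: "c s (k * n + j) = V (s k) (s (k + 1)) j" if "0 \<le> j" "j < n" for s k j
    using that by (simp add: c_def)
  \<comment> \<open>Consecutive connecting points both follow \<open>s (k + 1)\<close> just after
    their junction, so the earlier one stays valid for \<open>T\<close> more positions. Hence every
    window of length \<open>T\<close> lies in one connecting point.\<close>
  have c_next: "c s (k * n + j) = V (s k) (s (k + 1)) j" if s: "\<And>i. s i \<in> Y" and j: "0 \<le> j" "j < n + T" for s k j
  proof (cases "j < n")
    case True
    then show ?thesis using c_at j by simp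
  next
    case False
    have "c s (k * n + j) = c s ((k + 1) * n + (j - n))"
      by (simp add: distrib_right)
    also have "\<dots> = V (s (k + 1)) (s (k + 1 + 1)) (j - n)"
      using False j n by (intro c_at) auto
    also have "\<dots> = s (k + 1) (j - n)"
      using V[OF s[of "k + 1"] s[of "k + 1 + 1"], of "j - n"] False j by simp
    also have "\<dots> = V (s k) (s (k + 1)) j"
      using V[OF s[of k] s[of "k + 1"], of "j - n"] False j by simp
    finally show ?thesis .
  qed
  have c_in: "c s \<in> X" if s: "\<And>i. s i \<in> Y" for s
  proof (rule glue)
    fix i
    define k m where "k = i div n" and "m = i mod n"
    have i: "i = k * n + m" "0 \<le> m" "m < n"
      using n by (simp_all add: k_def m_def)
    have "c s j = translate (- (k * n)) (V (s k) (s (k + 1))) j" if "j \<in> {i..<i + T}" for j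
      using c_next[where s = s and j = "j - k * n" and k = k, OF s] that i by (simp add: translate_apply)
    then show "\<exists>v\<in>X. \<forall>j\<in>{i..<i + T}. c s j = v j"
      using translate_in[OF V_in[OF s s]] by blast
  qed
  have c_near: "c s (k * n + j) = s k j" if s: "\<And>i. s i \<in> Y" and j: "\<bar>j\<bar> < T" for s k j
  proof (cases "0 \<le> j")
    case True
    then show ?thesis using c_next[where s = s and j = j and k = k, OF s] V[OF s[of k] s[of "k + 1"], of j] j n by simp
  next
    case False
    have "c s (k * n + j) = c s ((k - 1) * n + (j + n))"
      by (simp add: left_diff_distrib)
    also have "\<dots> = V (s (k - 1)) (s (k - 1 + 1)) (j + n)"
      using False j n by (intro c_at) auto
    finally show ?thesis
      using V[OF s[of "k - 1"] s[of k], of j] j by simp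
  qed

  define Q where "Q = int (length ys) + 1"
  have Q: "2 \<le> Q" by (simp add: Q_def ys_def)
  \<comment> \<open>Index 0 of a block is \<open>x0\<close> whether the block is marked or not, so
    the connecting point that ends a block does not depend on the next block; this allows free
    concatenation. The entries of \<open>ys\<close> take the indices from 1 on, hence the
    subtraction.\<close>
  define sq where "sq S i = (if i mod Q \<noteq> 0 \<and> i div Q \<in> S then ys ! (nat (i mod Q) - 1) else x0)" for S i
  have sq_in: "sq S i \<in> Y" for S i
  proof -
    have "nat a - 1 < length ys" if "0 \<le> a" "a < Q" "a \<noteq> 0" for a
      using that unfolding Q_def by linarith
    moreover have "i mod Q < Q" "0 \<le> i mod Q" using Q by simp_all
    ultimately have "nat (i mod Q) - 1 < length ys" if "i mod Q \<noteq> 0"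
      using that by blast
    then show ?thesis using Y by (auto simp: sq_def)
  qed
  have sq_cong: "sq S i = sq S' i'" if "i mod Q = i' mod Q" "i div Q \<in> S \<longleftrightarrow> i' div Q \<in> S'" for S S' i i'
    using that by (simp add: sq_def)
  define u where "u S = c (sq S)" for S
  have u_near: "u S (k * n + j) = sq S k j" if "\<bar>j\<bar> < T" for S k j
    unfolding u_def by (rule c_near[OF sq_in that])
  have x_mark: "sq {0} (int t + 1) = ys ! t" if "t < length ys" for t
    using that by (simp add: sq_def Q_def nat_add_distrib)
  have u_mark: "u {0} ((int t + 1) * n + j) = (ys ! t) j" if "t < length ys" "\<bar>j\<bar> < T" for t j
    using u_near[OF that(2), of "{0}" "int t + 1"] x_mark[OF that(1)] by simp

  have "block_system X G r T (Q * n) u"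
  proof unfold_locales
    show "T \<le> Q * n"
    proof -
      have "1 * n \<le> Q * n" using n Q by (intro mult_right_mono) auto
      then show ?thesis using n by linarith
    qed
    show uX: "u S \<in> X" for S unfolding u_def by (rule c_in[OF sq_in])
    show "u S j = u S' j'" if iff: "j div (Q * n) \<in> S \<longleftrightarrow> j' div (Q * n) \<in> S'"
      and md: "j mod (Q * n) = j' mod (Q * n)" for S j S' j'
    proof -
      have dd: "l div (Q * n) = (l div n) div Q" for l
        using zdiv_zmult2_eq[of Q l n] Q by (simp add: mult.commute)
      have mm: "l mod (Q * n) = n * (l div n mod Q) + l mod n" for l
        using zmod_zmult2_eq[of Q l n] Q by (simp add: mult.commute)
      have "l mod (Q * n) mod n = l mod n" "l mod (Q * n) div n = l div n mod Q" for l
        unfolding mm using n by simp_all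
      then have m: "j mod n = j' mod n" "j div n mod Q = j' div n mod Q"
        using md by metis+
      have "sq S (j div n) = sq S' (j' div n)"
        using m iff by (intro sq_cong) (auto simp: dd)
      \<comment> \<open>The successor index either begins a new block, where the value is
        \<open>x0\<close>, or stays in the same block.\<close>
      moreover have "sq S (j div n + 1) = sq S' (j' div n + 1)"
      proof (cases "(j div n + 1) mod Q = 0")
        case True
        then have "(j' div n + 1) mod Q = 0" using m by (metis mod_add_left_eq)
        then show ?thesis using True by (simp add: sq_def)
      next
        case False
        have "(a + 1) div Q = a div Q" if "(a + 1) mod Q \<noteq> 0" for a
        proof -
          have "a + 1 = (a div Q) * Q + (a mod Q + 1)" by simp
          moreover have "a mod Q + 1 \<noteq> Q"
          proof
            assume "a mod Q + 1 = Q"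
            then have "a + 1 = (a div Q + 1) * Q"
              using calculation by (simp add: distrib_right)
            then show False using that by simp
          qed
          moreover have "0 \<le> a mod Q" "a mod Q < Q" using Q by simp_all
          ultimately have "(a + 1) div Q = a div Q + (a mod Q + 1) div Q"
            using Q by (metis div_mult_self3 add.commute less_irrefl not_numeral_le_zero)
          moreover have "(a mod Q + 1) div Q = 0"
            using \<open>a mod Q + 1 \<noteq> Q\<close> \<open>0 \<le> a mod Q\<close> \<open>a mod Q < Q\<close> by (intro div_pos_pos_trivial) auto
          ultimately show ?thesis by simp
        qed
        moreover have "(j' div n + 1) mod Q \<noteq> 0" using False m by (metis mod_add_left_eq)
        moreover have "(j div n + 1) mod Q = (j' div n + 1) mod Q" using m by (metis mod_add_left_eq)
        ultimately show ?thesis using False iff by (intro sq_cong) (auto simp: dd)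
      qed
      ultimately show ?thesis unfolding u_def c_def using m by simp
    qed
    show "u {0} \<noteq> u {}"
    proof
      assume "u {0} = u {}"
      then have "u {0} ((int 0 + 1) * n + 0) = u {} ((int 0 + 1) * n + 0)" by simp
      then have "(ys ! 0) 0 = sq {} (int 0 + 1) 0"
        using u_mark[of 0 0] u_near[of 0 "{}" "int 0 + 1"] T by (simp add: ys_def)
      then show False using xy0 by (simp add: ys_def sq_def)
    qed
    show "g (u {0}) \<noteq> u {0}" if g: "g \<in> G" "g \<noteq> (\<lambda>x\<in>X. x)" for g
    proof
      assume fixed: "g (u {0}) = u {0}"
      obtain t where t: "t < length gs" "gs ! t = g" using gs g by (metis in_set_conv_nth)
      have m: "ys ! Suc t = mv g" "Suc t < length ys"
        using t g by (simp_all add: ys_def move_def)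
      let ?p = "(int (Suc t) + 1) * n"
      \<comment> \<open>Here \<open>u {0}\<close> copies \<open>mv g\<close> on a window wider than
        the radius \<open>r\<close>, so \<open>g\<close> changes the middle letter as it does in
        \<open>mv g\<close>.\<close>
      have near: "u {0} (?p + q) = mv g q" if "\<bar>q\<bar> < T" for q
        using u_mark[OF m(2) that] m(1) by simp
      have "g (u {0}) ?p = g (mv g) 0"
        using near T mv[OF g] by (intro G_local_at[OF g(1) uX]) auto
      then show False
        using fixed near[of 0] mv[OF g] T by simp
    qed
  qed
  then show ?thesis by blast
qed

end

section \<open>The embedding\<close>

lemma sft_glue:
  assumes "sft \<Sigma> X"
  obtains T0 :: int where "\<And>T u. \<lbrakk>T0 \<le> T; \<And>i. \<exists>v\<in>X. \<forall>j\<in>{i..<i+T}. u j = v j\<rbrakk> \<Longrightarrow> u \<in> X"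
proof -
  obtain F where fin: "finite F" and X: "X = {x \<in> full_shift \<Sigma>. \<forall>w\<in>F. \<forall>i. \<not> occurs_at w x i}"
    using assms by (auto simp: sft_def)
  \<comment> \<open>Forbidden words fit into windows of this length; the 1 makes the windows
    nonempty, so that they also check the alphabet.\<close>
  define T0 where "T0 = int (Max (insert 1 (length ` F)))"
  have T0: "int (length w) \<le> T0" if "w \<in> F" for w
    unfolding T0_def of_nat_le_iff using fin that by (intro Max_ge) auto
  have "1 \<le> T0" unfolding T0_def using fin by (simp add: Max_ge_iff)
  show thesis
  proof (rule that[of T0])
    fix T u assume T: "T0 \<le> T" and win: "\<And>i. \<exists>v\<in>X. \<forall>j\<in>{i..<i+T}. u j = v j"
    have "u i \<in> \<Sigma>" for i
    proof -
      obtain v where "v \<in> X" "\<forall>j\<in>{i..<i+T}. u j = v j" using win by blast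
      then show ?thesis using T \<open>1 \<le> T0\<close> X by auto
    qed
    moreover have "\<not> occurs_at w u i" if w: "w \<in> F" for w i
    proof
      assume occ: "occurs_at w u i"
      obtain v where v: "v \<in> X" "\<And>j. j \<in> {i..<i+T} \<Longrightarrow> u j = v j" using win by blast
      have "v (i + int k) = w ! k" if "k < length w" for k
        using occ v(2)[of "i + int k"] T T0[OF w] that by (simp add: occurs_at_def)
      then have "occurs_at w v i" by (simp add: occurs_at_def)
      then show False using v(1) w unfolding X by blast
    qed
    ultimately show "u \<in> X" unfolding X by auto
  qed
qed

lemma mixing_windows:
  assumes X: "X \<subseteq> full_shift \<Sigma>" and mix: "mixing \<Sigma> X" and xy: "x \<in> X" "y \<in> X"
  shows "\<exists>N. \<forall>n\<ge>N. \<exists>v\<in>X. \<forall>j. \<bar>j\<bar> \<le> L \<longrightarrow> v j = x j \<and> v (j + int n) = y j"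
proof -
  define C where "C z = {v \<in> X. \<forall>j. \<bar>j\<bar> \<le> L \<longrightarrow> v j = z j}" for z
  have "openin (subtopology (full_topology \<Sigma>) X) (C z)" for z
    unfolding openin_subtopology_full_iff[OF X] C_def by (auto intro!: exI[of _ L])
  moreover have "C x \<noteq> {}" "C y \<noteq> {}" using xy by (auto simp: C_def)
  ultimately obtain N where N: "\<forall>n\<ge>N. (shift ^^ n) ` C x \<inter> C y \<noteq> {}"
    using mix[unfolded mixing_def, rule_format, of "C x" "C y"] by metis
  have "\<exists>v\<in>X. \<forall>j. \<bar>j\<bar> \<le> L \<longrightarrow> v j = x j \<and> v (j + int n) = y j" if n: "N \<le> n" for n
  proof -
    obtain v where "v \<in> C x" "(shift ^^ n) v \<in> C y" using N n by blast
    then show ?thesis unfolding C_def shift_power by (auto simp: translate_apply)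
  qed
  then show ?thesis by blast
qed

lemma Aut_trivial:
  assumes "\<And>x y. \<lbrakk>x \<in> X; y \<in> X\<rbrakk> \<Longrightarrow> x = y" "f \<in> carrier (Aut \<Sigma> X)"
  shows "f = (\<lambda>x\<in>X. x)"
  using assms by (intro extensionalityI[of _ X]) (auto simp: Aut_def Bij_def bij_betw_def)

lemma subgroup_Aut_shift_action:
  assumes \<Sigma>: "finite \<Sigma>" and X: "sft \<Sigma> X" and G: "subgroup G (Aut \<Sigma> X)" "finite G"
  obtains r T where "shift_action X G r T"
proof -
  have sub: "subshift \<Sigma> X" using X by (simp add: sft_def)
  interpret group "Aut \<Sigma> X" by (rule group_Aut[OF sub])
  have GA: "g \<in> carrier (Aut \<Sigma> X)" if "g \<in> G" for g
    using subgroup.mem_carrier[OF G(1) that] .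
  have "\<exists>r. \<forall>x\<in>X. \<forall>y\<in>X. (\<forall>j. \<bar>j\<bar> \<le> r \<longrightarrow> x j = y j) \<longrightarrow> g x 0 = g y 0" if "g \<in> G" for g
    by (rule Aut_local[OF \<Sigma> sub GA[OF that]]) blast
  then obtain rad where rad: "\<And>g x y. \<lbrakk>g \<in> G; x \<in> X; y \<in> X; \<And>j. \<bar>j\<bar> \<le> rad g \<Longrightarrow> x j = y j\<rbrakk> \<Longrightarrow> g x 0 = g y 0"
    by metis
  obtain T0 where glue: "\<And>T u. \<lbrakk>T0 \<le> T; \<And>i. \<exists>v\<in>X. \<forall>j\<in>{i..<i+T}. u j = v j\<rbrakk> \<Longrightarrow> u \<in> X"
    by (rule sft_glue[OF X]) blast
  define r where "r = Max (insert 0 (rad ` G))"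
  have r: "0 \<le> r" "rad g \<le> r" if "g \<in> G" for g
    unfolding r_def using G that by (auto intro: Max_ge)
  have r0: "0 \<le> r" unfolding r_def using G by (auto intro: Max_ge)
  have "shift_action X G r (max T0 (2 * r + 1))"
  proof
    show "translate k x \<in> X" if "x \<in> X" for x k
      using closed_under_translate that sub by (auto simp: subshift_def)
    fix g assume g: "g \<in> G"
    note D = Aut_D[OF sub GA[OF g]]
    show "g \<in> extensional X" by (rule D)
    show "g x \<in> X" if "x \<in> X" for x using D(2) that by blast
    show "g (translate k x) = translate k (g x)" if "x \<in> X" for k x by (rule D(3)[OF that])
    show "g x 0 = g y 0" if "x \<in> X" "y \<in> X" "\<And>j. \<bar>j\<bar> \<le> r \<Longrightarrow> x j = y j" for x y
      using rad[OF g that(1,2)] that(3) r[OF g] by force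
    show "compose X g h \<in> G" if "h \<in> G" for h
      using subgroup.m_closed[OF G(1) g that] Aut_mult[OF GA GA, OF g that] by simp
    show "\<exists>h\<in>G. compose X h g = (\<lambda>x\<in>X. x) \<and> compose X g h = (\<lambda>x\<in>X. x)"
    proof (intro bexI conjI)
      show h: "inv\<^bsub>Aut \<Sigma> X\<^esub> g \<in> G" by (rule subgroup.m_inv_closed[OF G(1) g])
      show "compose X (inv\<^bsub>Aut \<Sigma> X\<^esub> g) g = (\<lambda>x\<in>X. x)" "compose X g (inv\<^bsub>Aut \<Sigma> X\<^esub> g) = (\<lambda>x\<in>X. x)"
        using l_inv[OF GA[OF g]] r_inv[OF GA[OF g]]
        unfolding Aut_mult[OF GA[OF h] GA[OF g]] Aut_mult[OF GA[OF g] GA[OF h]] Aut_one by simp_all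
    qed
  next
    show "(\<lambda>x\<in>X. x) \<in> G" using subgroup.one_closed[OF G(1)] by (simp add: Aut_one)
    show "finite G" by (rule G)
    show "0 \<le> r" by (rule r0)
    show "2 * r + 1 \<le> max T0 (2 * r + 1)" by simp
    show "u \<in> X" if "\<And>i. \<exists>v\<in>X. \<forall>j\<in>{i..<i + max T0 (2 * r + 1)}. u j = v j" for u
      by (rule glue[OF _ that]) simp
  qed
  then show thesis by (rule that)
qed

text \<open>The parameters are chosen in succession: the blocks fix \<open>P\<close>, the
  displacements up to \<open>2 * P\<close> fix \<open>R\<close>, and then \<open>M\<close> and
  \<open>K\<close> follow.\<close>

lemma (in shift_action) belts_exist:
  assumes mix: "\<And>x y L. x \<in> X \<Longrightarrow> y \<in> X \<Longrightarrow>
      \<exists>N. \<forall>n\<ge>N. \<exists>v\<in>X. \<forall>j. \<bar>j\<bar> \<le> L \<longrightarrow> v j = x j \<and> v (j + int n) = y j"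
    and nontrivial: "x1 \<in> X" "x2 \<in> X" "x1 \<noteq> x2" and "finite \<Gamma>"
  obtains W n lo hi E where "belts X G r T \<Gamma> W n lo hi E"
proof -
  obtain P u where "block_system X G r T P u"
    using block_system_exists[OF mix nontrivial] by blast
  then interpret block_system X G r T P u .
  obtain R where R: "0 \<le> R" "\<And>g k. \<lbrakk>g \<in> G; \<bar>k\<bar> \<le> 2 * P; \<not> (k = 0 \<and> g = (\<lambda>x\<in>X. x))\<rbrakk> \<Longrightarrow>
      \<exists>j. \<bar>j\<bar> \<le> R \<and> g (u {0}) (j + k) \<noteq> u {0} j"
    by (rule displacement_bound[of "2 * P"]) blast
  obtain e :: "'b \<times> 'b \<Rightarrow> nat" and N where e: "e ` (\<Gamma> \<times> \<Gamma>) = {i. i < N}" "inj_on e (\<Gamma> \<times> \<Gamma>)"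
    using finite_imp_inj_to_nat_seg[of "\<Gamma> \<times> \<Gamma>"] \<open>finite \<Gamma>\<close> by auto
  define M where "M = R + 2 * P + r + 3"
  interpret marker_words X G r T P u R M "int N" "M + int N + 6"
    by unfold_locales (use R P_pos r_nonneg in \<open>simp_all add: M_def\<close>)
  have inj: "inj_on (\<lambda>a. int (e a)) (\<Gamma> \<times> \<Gamma>)"
    using e(2) by (simp add: inj_on_def)
  have "(\<lambda>a. int (e a)) ` (\<Gamma> \<times> \<Gamma>) \<subseteq> {0..int N}"
  proof (rule image_subsetI)
    fix a assume "a \<in> \<Gamma> \<times> \<Gamma>"
    then have "e a \<in> {i. i < N}" using e(1) by blast
    then show "int (e a) \<in> {0..int N}" by simp
  qed
  from cell_words[OF inj this] show thesis
    by (intro that) (rule belts.intro)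
qed

text \<open>If \<open>\<Gamma>\<close> has two letters, the shift is a nontrivial automorphism of
  the full shift, whereas an \<open>X\<close> with at most one point has a trivial automorphism
  group; \<open>nontrivial\<close> excludes this degenerate case.\<close>

theorem theorem2p4:
  fixes \<Sigma> :: "'a set" and X :: "(int \<Rightarrow> 'a) set"
    and G :: "((int \<Rightarrow> 'a) \<Rightarrow> (int \<Rightarrow> 'a)) set"
    and \<Gamma> :: "'b set"
  assumes "finite \<Sigma>"
    and "sft \<Sigma> X" and "mixing \<Sigma> X"
    and "subgroup G (Aut \<Sigma> X)" and "finite G"
    and "finite \<Gamma>"
    and nontrivial: "card \<Gamma> \<ge> 2 \<Longrightarrow> \<exists>x\<in>X. \<exists>y\<in>X. x \<noteq> y"
  shows "\<exists>\<phi>. \<phi> \<in> hom (Aut \<Gamma> (full_shift \<Gamma>)) (Aut \<Sigma> X) \<and>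
             inj_on \<phi> (carrier (Aut \<Gamma> (full_shift \<Gamma>))) \<and>
             (\<forall>f \<in> carrier (Aut \<Gamma> (full_shift \<Gamma>)). \<forall>g \<in> G.
                \<phi> f \<otimes>\<^bsub>Aut \<Sigma> X\<^esub> g = g \<otimes>\<^bsub>Aut \<Sigma> X\<^esub> \<phi> f)"
proof -
  let ?A = "Aut \<Gamma> (full_shift \<Gamma>)"
  have sub: "subshift \<Sigma> X" using \<open>sft \<Sigma> X\<close> by (simp add: sft_def)
  interpret A: group ?A by (rule group_Aut[OF subshift_full_shift])
  interpret AX: group "Aut \<Sigma> X" by (rule group_Aut[OF sub])
  have GA: "g \<in> carrier (Aut \<Sigma> X)" if "g \<in> G" for g
    using subgroup.mem_carrier[OF assms(4) that] .
  show ?thesis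
  proof (cases "card \<Gamma> \<ge> 2")
    case False
    \<comment> \<open>With at most one letter the full shift has at most one point, its automorphism
      group is trivial, and a constant map suffices.\<close>
    have eq: "x = y" if "x \<in> full_shift \<Gamma>" "y \<in> full_shift \<Gamma>" for x y
    proof
      fix i
      have "x i \<in> \<Gamma>" "y i \<in> \<Gamma>" using that by auto
      moreover have "card \<Gamma> \<le> Suc 0" using False by simp
      ultimately show "x i = y i"
        using \<open>finite \<Gamma>\<close> card_le_Suc0_iff_eq by blast
    qed
    have "inj_on (\<lambda>_. \<one>\<^bsub>Aut \<Sigma> X\<^esub>) (carrier ?A)"
    proof (rule inj_onI)
      fix f h assume "f \<in> carrier ?A" "h \<in> carrier ?A"
      then have "f = (\<lambda>x\<in>full_shift \<Gamma>. x)" "h = (\<lambda>x\<in>full_shift \<Gamma>. x)"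
        using Aut_trivial[OF eq] by blast+
      then show "f = h" by simp
    qed
    then show ?thesis
      using GA by (intro exI[of _ "\<lambda>_. \<one>\<^bsub>Aut \<Sigma> X\<^esub>"]) (auto simp: hom_def)
  next
    case True
    then obtain x1 x2 where x12: "x1 \<in> X" "x2 \<in> X" "x1 \<noteq> x2" using nontrivial by blast
    have XF: "X \<subseteq> full_shift \<Sigma>"
      using sub closedin_subset[of "full_topology \<Sigma>" X] by (auto simp: subshift_def)
    obtain r T where "shift_action X G r T"
      by (rule subgroup_Aut_shift_action[OF assms(1,2,4,5)])
    then interpret shift_action X G r T .
    obtain W n lo hi E where "belts X G r T \<Gamma> W n lo hi E"
      by (rule belts_exist[OF mixing_windows[OF XF \<open>mixing \<Sigma> X\<close>] x12 \<open>finite \<Gamma>\<close>])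
    then interpret belts X G r T \<Gamma> W n lo hi E .
    have endo: "endo f" if "f \<in> carrier ?A" for f
      using Aut_D[OF subshift_full_shift that] unfolding endo_def by blast
    have mult: "belt_map (f \<otimes>\<^bsub>?A\<^esub> h) x = belt_map f (belt_map h x)"
      if "f \<in> carrier ?A" "h \<in> carrier ?A" "x \<in> X" for f h x
      unfolding Aut_mult[OF that(1,2)] by (rule belt_map_compose[OF endo endo]) (fact that)+
    have local: "\<exists>s. \<forall>x\<in>X. \<forall>y\<in>X. (\<forall>j. \<bar>j\<bar> \<le> s \<longrightarrow> x j = y j) \<longrightarrow> belt_map f x 0 = belt_map f y 0"
      if f: "f \<in> carrier ?A" for f
    proof -
      obtain \<rho> where \<rho>: "\<rho> \<ge> 0" "\<And>x y. x \<in> full_shift \<Gamma> \<Longrightarrow> y \<in> full_shift \<Gamma> \<Longrightarrow>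
          (\<And>j. \<bar>j\<bar> \<le> \<rho> \<Longrightarrow> x j = y j) \<Longrightarrow> f x 0 = f y 0"
        by (rule Aut_local[OF \<open>finite \<Gamma>\<close> subshift_full_shift f]) blast
      show ?thesis
        using belt_map_local[OF endo[OF f] \<rho>] by (intro exI[of _ "(\<rho> + 3) * n + r"]) blast
    qed
    have inverse: "belt_map f (belt_map h x) = x"
      if "f \<in> carrier ?A" "h \<in> carrier ?A" "f \<otimes>\<^bsub>?A\<^esub> h = \<one>\<^bsub>?A\<^esub>" "x \<in> X" for f h x
      using mult[OF that(1,2,4)] belt_map_id[OF that(4)] that(3) by (simp add: Aut_one)
    have closed: "belt_map f \<in> carrier (Aut \<Sigma> X)" if f: "f \<in> carrier ?A" for f
    proof -
      \<comment> \<open>The inverse automorphism has a radius of its own, so its belt map supplies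
        the inverse together with its continuity.\<close>
      let ?h = "inv\<^bsub>?A\<^esub> f"
      have h: "?h \<in> carrier ?A" using f by simp
      obtain s where s: "\<forall>x\<in>X. \<forall>y\<in>X. (\<forall>j. \<bar>j\<bar> \<le> s \<longrightarrow> x j = y j) \<longrightarrow> belt_map f x 0 = belt_map f y 0"
        using local[OF f] by blast
      obtain t where t: "\<forall>x\<in>X. \<forall>y\<in>X. (\<forall>j. \<bar>j\<bar> \<le> t \<longrightarrow> x j = y j) \<longrightarrow> belt_map ?h x 0 = belt_map ?h y 0"
        using local[OF h] by blast
      show ?thesis
      proof (rule Aut_I[OF sub belt_map_extensional belt_map_in[OF endo[OF f]] belt_map_in[OF endo[OF h]]])
        show "belt_map ?h (belt_map f x) = x" if "x \<in> X" for x
          using inverse[OF h f A.l_inv[OF f] that] .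
        show "belt_map f (belt_map ?h x) = x" if "x \<in> X" for x
          using inverse[OF f h A.r_inv[OF f] that] .
        show "belt_map f (translate k x) = translate k (belt_map f x)" if "x \<in> X" for k x
          by (rule belt_map_translate[OF endo[OF f] that])
        show "belt_map f x 0 = belt_map f y 0" if "x \<in> X" "y \<in> X" "\<And>j. \<bar>j\<bar> \<le> s \<Longrightarrow> x j = y j" for x y
          using s that by blast
        show "belt_map ?h x 0 = belt_map ?h y 0" if "x \<in> X" "y \<in> X" "\<And>j. \<bar>j\<bar> \<le> t \<Longrightarrow> x j = y j" for x y
          using t that by blast
      qed
    qed
    have "belt_map (f \<otimes>\<^bsub>?A\<^esub> h) = belt_map f \<otimes>\<^bsub>Aut \<Sigma> X\<^esub> belt_map h"
      if f: "f \<in> carrier ?A" and h: "h \<in> carrier ?A" for f h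
    proof (rule extensionalityI[of _ X])
      show "belt_map (f \<otimes>\<^bsub>?A\<^esub> h) x = (belt_map f \<otimes>\<^bsub>Aut \<Sigma> X\<^esub> belt_map h) x" if "x \<in> X" for x
        using mult[OF f h that] that by (simp add: Aut_mult[OF closed[OF f] closed[OF h]] compose_def)
    qed (simp_all add: belt_map_extensional Aut_mult[OF closed[OF f] closed[OF h]])
    then have "belt_map \<in> hom ?A (Aut \<Sigma> X)"
      using closed by (simp add: hom_def)
    moreover have "inj_on belt_map (carrier ?A)"
    proof (rule inj_onI)
      fix f h assume f: "f \<in> carrier ?A" and h: "h \<in> carrier ?A" and eq: "belt_map f = belt_map h"
      show "f = h"
      proof (rule extensionalityI[of _ "full_shift \<Gamma>"])
        show "f v = h v" if "v \<in> full_shift \<Gamma>" for v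
          by (rule belt_map_inj[OF endo[OF f] endo[OF h] _ that]) (simp add: eq)
      qed (rule Aut_D[OF subshift_full_shift f] Aut_D[OF subshift_full_shift h])+
    qed
    moreover have "belt_map f \<otimes>\<^bsub>Aut \<Sigma> X\<^esub> g = g \<otimes>\<^bsub>Aut \<Sigma> X\<^esub> belt_map f"
      if f: "f \<in> carrier ?A" and g: "g \<in> G" for f g
      unfolding Aut_mult[OF closed[OF f] GA[OF g]] Aut_mult[OF GA[OF g] closed[OF f]]
      using belt_map_action[OF endo[OF f] _ g] by (simp add: compose_def cong: restrict_cong)
    ultimately show ?thesis by blast
  qed
qed

end
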